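(* Let $n\ge1$. For every probability density $\rho$ on $\mathbb{R}^n$ with finite second moment, $$M_2[\rho]-M_2[\rho^*]\ \ge\ W_2^2(\rho,\rho^* ).$$
   Context: Probability densities are taken with respect to Lebesgue measure and identified with the corresponding probability measures. $M_2[\rho]:=\int_{\mathbb{R}^n}\rho(x)|x|^2\,dx$ is the second moment. $\rho^*$ denotes the radially symmetric decreasing rearrangement of $\rho$: $\rho^*(x)=\int_0^\infty 1_{D_h^*}(x)\,dh$ with $D_h=\{\rho>h\}$, where for a set $D$ of finite measure $D^*$ is the ball centered at the origin with $|D^*|=|D|$. $W_2(\cdot,\cdot)$ is the 2-Wasserstein distance between probability measures with finite second moment. *)

theory Defs
  imports "HOL-Probability.Probability"
begin

text \<open>
  Densities take values in \<^typ>\<open>ennreal\<close>: the rearrangement of an unbounded density is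
  infinite at the origin. They are only required to be Lebesgue measurable.
\<close>

definition prob_density :: "('a::euclidean_space \<Rightarrow> ennreal) \<Rightarrow> bool" where
  "prob_density \<rho> \<longleftrightarrow>
     \<rho> \<in> borel_measurable lebesgue \<and> (\<integral>\<^sup>+ x. \<rho> x \<partial>lebesgue) = 1"

text \<open>The image under the identity restricts \<^term>\<open>density lebesgue \<rho>\<close> to the Borel sets.\<close>

definition density_measure :: "('a::euclidean_space \<Rightarrow> ennreal) \<Rightarrow> 'a measure" where
  "density_measure \<rho> = distr (density lebesgue \<rho>) borel (\<lambda>x. x)"

definition second_moment :: "('a::euclidean_space \<Rightarrow> ennreal) \<Rightarrow> ennreal" where
  "second_moment \<rho> = (\<integral>\<^sup>+ x. \<rho> x * ennreal ((norm x)\<^sup>2) \<partial>lebesgue)"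

text \<open>
  Meaningful for measurable \<open>D\<close> of finite measure, where the radius is unique. The ball is
  open, so a null set is rearranged into the empty set.
\<close>

definition sym_ball :: "'a::euclidean_space set \<Rightarrow> 'a set" where
  "sym_ball D = ball 0 (THE r. 0 \<le> r \<and> emeasure lebesgue (ball (0::'a) r) = emeasure lebesgue D)"

text \<open>
  The superlevel sets of an integrable density have finite measure for every \<open>h > 0\<close>; the
  level \<open>h = 0\<close>, where this may fail, is left out of the integral.
\<close>

definition sym_decr_rearrangement :: "('a::euclidean_space \<Rightarrow> ennreal) \<Rightarrow> 'a \<Rightarrow> ennreal" where
  "sym_decr_rearrangement \<rho> x =
     (\<integral>\<^sup>+ h\<in>{0<..}. indicator (sym_ball {y. \<rho> y > ennreal h}) x \<partial>lborel)"

definition couplings :: "'a::euclidean_space measure \<Rightarrow> 'a measure \<Rightarrow> ('a \<times> 'a) measure set" where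
  "couplings \<mu> \<nu> =
     {\<pi>. prob_space \<pi> \<and> sets \<pi> = sets (borel \<Otimes>\<^sub>M borel) \<and>
         distr \<pi> borel fst = \<mu> \<and> distr \<pi> borel snd = \<nu>}"

definition ennreal_sqrt :: "ennreal \<Rightarrow> ennreal" where
  "ennreal_sqrt c = (if c = \<infinity> then \<infinity> else ennreal (sqrt (enn2real c)))"

definition wasserstein2 :: "'a::euclidean_space measure \<Rightarrow> 'a measure \<Rightarrow> ennreal" where
  "wasserstein2 \<mu> \<nu> =
     ennreal_sqrt (INF \<pi>\<in>couplings \<mu> \<nu>. \<integral>\<^sup>+ z. ennreal ((dist (fst z) (snd z))\<^sup>2) \<partial>\<pi>)"

end

theory Submission
  imports Defs
begin

text \<open>
  The layer cake formula reduces the problem to a bounded set \<open>D\<close> and the centred ball \<open>B\<close> of the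
  same volume. Cut the pair \<open>(D, B)\<close> again and again by parallel hyperplanes in equal proportions
  of mass, as in the Hadwiger--Ohmann proof of the Brunn--Minkowski inequality, until all pieces lie
  in small boxes, and couple corresponding pieces by product measures. For each \<open>t > 0\<close> the
  boxes \<open>t P + Q\<close> of the pieces are disjoint and each has volume at least
  \<open>(1 + t)\<^sup>n\<close> times the mass coupled in it, so up to a small error the law of \<open>t x + y\<close> has
  density at most \<open>(1 + t)\<^sup>-\<^sup>n\<close>; its second moment is therefore at least \<open>(1 + t)\<^sup>2\<close> times that
  of \<open>B\<close>. The identity
  \<open>|t x + y|\<^sup>2 + t |x - y|\<^sup>2 = t (1 + t) |x|\<^sup>2 + (1 + t) |y|\<^sup>2\<close> turns this into
  an upper bound for the transport cost as \<open>t\<close> tends to 0. For a density, finitely many truncated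
  superlevel sets are coupled in this way; the remaining mass is coupled by a product measure, whose
  cost is negligible.
\<close>

subsection \<open>Densities of couplings\<close>

text \<open>Write M for second moments and E for the coupled integral of the inner product of x and
  y. The cost of a coupling of \<open>D\<close> and \<open>B\<close> is M(D) + M(B) - 2 E, so the
  claim for sets says E \<ge> M(B). The law of t x + y has second moment M(B) + 2 t E + t^2 M(D);
  comparing this with (1 + t)^2 M(B) at first order in t yields exactly that. A smooth
  volume-preserving transport of \<open>B\<close> onto \<open>D\<close> with positive triangular
  derivative would give the same from its divergence being at least n, by arithmetic-geometric
  means. Repeated cutting replaces that map by finitely many product couplings, and the means
  inequality is applied to the side lengths of two boxes. The price is that t x + y is controlled
  only up to the diameter of a cell, while the comparison is finally divided by t. Hence t is fixed
  by the admissible error, and the cells are then made small relative to t. The coupling depends on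
  the error, which an infimum over couplings tolerates.\<close>

text \<open>Every coupling built here is absolutely continuous, so it is stored as a density, and
  couplings can be added and scaled pointwise. The marginals are prescribed almost everywhere
  because a product of two null functions recovers them only up to null sets.\<close>

definition coupling_density ::
  "('a::euclidean_space \<Rightarrow> ennreal) \<Rightarrow> ('a \<Rightarrow> ennreal) \<Rightarrow> ('a \<times> 'a \<Rightarrow> ennreal) \<Rightarrow> bool" where
  "coupling_density f g k \<longleftrightarrow>
     k \<in> borel_measurable (lborel \<Otimes>\<^sub>M lborel) \<and>
     (AE x in lborel. (\<integral>\<^sup>+ y. k (x, y) \<partial>lborel) = f x) \<and>
     (AE y in lborel. (\<integral>\<^sup>+ x. k (x, y) \<partial>lborel) = g y)"

lemma coupling_density_measurable:
  "coupling_density f g k \<Longrightarrow> k \<in> borel_measurable (lborel \<Otimes>\<^sub>M lborel)"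
  by (simp add: coupling_density_def)

lemma nn_integral_coupling_fst:
  fixes k :: "'a::euclidean_space \<times> 'a \<Rightarrow> ennreal"
  assumes "coupling_density f g k" and [measurable]: "\<phi> \<in> borel_measurable borel"
  shows "(\<integral>\<^sup>+ z. \<phi> (fst z) * k z \<partial>(lborel \<Otimes>\<^sub>M lborel)) = (\<integral>\<^sup>+ x. \<phi> x * f x \<partial>lborel)"
proof -
  have [measurable]: "k \<in> borel_measurable (lborel \<Otimes>\<^sub>M lborel)"
    and ae: "AE x in lborel. (\<integral>\<^sup>+ y. k (x, y) \<partial>lborel) = f x"
    using assms by (auto simp: coupling_density_def)
  have "(\<integral>\<^sup>+ z. \<phi> (fst z) * k z \<partial>(lborel \<Otimes>\<^sub>M lborel)) = (\<integral>\<^sup>+ x. \<integral>\<^sup>+ y. \<phi> x * k (x, y) \<partial>lborel \<partial>lborel)"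
    by (subst lborel.nn_integral_fst[symmetric]) auto
  also have "\<dots> = (\<integral>\<^sup>+ x. \<phi> x * (\<integral>\<^sup>+ y. k (x, y) \<partial>lborel) \<partial>lborel)"
    by (intro nn_integral_cong nn_integral_cmult) auto
  also have "\<dots> = (\<integral>\<^sup>+ x. \<phi> x * f x \<partial>lborel)"
    using ae by (intro nn_integral_cong_AE) auto
  finally show ?thesis .
qed

lemma coupling_density_swap:
  assumes "coupling_density f g k"
  shows "coupling_density g f (\<lambda>z. k (snd z, fst z))"
  using assms unfolding coupling_density_def
  by (auto intro!: measurable_compose[of "\<lambda>z. (snd z, fst z)" _ "lborel \<Otimes>\<^sub>M lborel" k])

lemma nn_integral_swap:
  fixes h :: "'a::euclidean_space \<times> 'a \<Rightarrow> ennreal"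
  assumes [measurable]: "h \<in> borel_measurable (lborel \<Otimes>\<^sub>M lborel)"
  shows "(\<integral>\<^sup>+ z. h (snd z, fst z) \<partial>(lborel \<Otimes>\<^sub>M lborel)) = (\<integral>\<^sup>+ z. h z \<partial>(lborel \<Otimes>\<^sub>M lborel))"
proof -
  have "(\<integral>\<^sup>+ z. h (snd z, fst z) \<partial>(lborel \<Otimes>\<^sub>M lborel)) = (\<integral>\<^sup>+ x. \<integral>\<^sup>+ y. h (y, x) \<partial>lborel \<partial>lborel)"
    by (subst lborel.nn_integral_fst[symmetric]) auto
  also have "\<dots> = (\<integral>\<^sup>+ z. h z \<partial>(lborel \<Otimes>\<^sub>M lborel))"
    using lborel_pair.nn_integral_snd[of h] by simp
  finally show ?thesis .
qed

lemma nn_integral_coupling_snd: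
  fixes k :: "'a::euclidean_space \<times> 'a \<Rightarrow> ennreal"
  assumes "coupling_density f g k" and [measurable]: "\<phi> \<in> borel_measurable borel"
  shows "(\<integral>\<^sup>+ z. \<phi> (snd z) * k z \<partial>(lborel \<Otimes>\<^sub>M lborel)) = (\<integral>\<^sup>+ x. \<phi> x * g x \<partial>lborel)"
proof -
  note [measurable] = coupling_density_measurable[OF assms(1)]
  show ?thesis
    using nn_integral_coupling_fst[OF coupling_density_swap[OF assms(1)] assms(2)]
      nn_integral_swap[of "\<lambda>z. \<phi> (snd z) * k z"] by simp
qed

lemma coupling_density_mass:
  assumes "coupling_density f g k"
  shows "(\<integral>\<^sup>+ z. k z \<partial>(lborel \<Otimes>\<^sub>M lborel)) = (\<integral>\<^sup>+ x. f x \<partial>lborel)"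
  using nn_integral_coupling_fst[OF assms, of "\<lambda>_. 1"] by simp

lemma coupling_density_add:
  assumes "coupling_density f\<^sub>1 g\<^sub>1 k\<^sub>1" "coupling_density f\<^sub>2 g\<^sub>2 k\<^sub>2"
  shows "coupling_density (\<lambda>x. f\<^sub>1 x + f\<^sub>2 x) (\<lambda>x. g\<^sub>1 x + g\<^sub>2 x) (\<lambda>z. k\<^sub>1 z + k\<^sub>2 z)"
proof -
  have [measurable]: "k\<^sub>1 \<in> borel_measurable (lborel \<Otimes>\<^sub>M lborel)" "k\<^sub>2 \<in> borel_measurable (lborel \<Otimes>\<^sub>M lborel)"
    using assms by (auto simp: coupling_density_def)
  show ?thesis
    using assms unfolding coupling_density_def by (auto simp: nn_integral_add)
qed

lemma coupling_density_cmult: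
  assumes "coupling_density f g k"
  shows "coupling_density (\<lambda>x. c * f x) (\<lambda>x. c * g x) (\<lambda>z. c * k z)"
proof -
  have [measurable]: "k \<in> borel_measurable (lborel \<Otimes>\<^sub>M lborel)"
    using assms by (auto simp: coupling_density_def)
  show ?thesis
    using assms unfolding coupling_density_def by (auto simp: nn_integral_cmult)
qed

lemma coupling_density_sum:
  assumes "finite I" "\<And>i. i \<in> I \<Longrightarrow> coupling_density (f i) (g i) (k i)"
  shows "coupling_density (\<lambda>x. \<Sum>i\<in>I. f i x) (\<lambda>x. \<Sum>i\<in>I. g i x) (\<lambda>z. \<Sum>i\<in>I. k i z)"
  using assms
proof (induction I)
  case empty
  then show ?case by (simp add: coupling_density_def)
next
  case (insert i I)
  then show ?case using coupling_density_add[of "f i" "g i" "k i"] by simp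
qed

lemma coupling_density_product:
  fixes f g :: "'a::euclidean_space \<Rightarrow> ennreal"
  assumes [measurable]: "f \<in> borel_measurable borel" "g \<in> borel_measurable borel"
    and m: "(\<integral>\<^sup>+ x. f x \<partial>lborel) = m" "(\<integral>\<^sup>+ x. g x \<partial>lborel) = m" "m < \<infinity>"
  shows "coupling_density f g (\<lambda>z. f (fst z) * g (snd z) / m)"
proof (cases "m = 0")
  case True
  then have "AE x in lborel. f x = 0" "AE x in lborel. g x = 0"
    using m by (simp_all add: nn_integral_0_iff_AE)
  \<comment> \<open>Division by zero can make the quotient infinite, but only on a product of two
    null sets.\<close>
  with True show ?thesis
    unfolding coupling_density_def
    by (auto simp: ennreal_divide_times nn_integral_0_iff_AE divide_ennreal_def ennreal_top_mult mult.assoc elim!: AE_mp)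
next
  case False
  then have "a * m / m = a" for a
    using m(3) by (metis ennreal_divide_self ennreal_times_divide infinity_ennreal_def mult.right_neutral)
  then show ?thesis
    using m unfolding coupling_density_def
    by (auto simp: nn_integral_divide nn_integral_cmult nn_integral_multc mult.commute[of m])
qed

subsection \<open>Couplings of parallel boxes\<close>

declare borel_open [OF open_ball, measurable]

text \<open>The bathtub principle: the product of |z|^2 - r^2 and \<theta>(z) - 1_B(z) is
  nonnegative at every point, and the r^2 terms cancel on integration because the masses agree. It
  is written with sums only, since subtraction in \<open>ennreal\<close> truncates. It serves both
  for the smeared law of t x + y and for single superlevel sets.\<close>

lemma bathtub_ball:
  fixes \<theta> :: "'a::euclidean_space \<Rightarrow> ennreal"
  assumes [measurable]: "\<theta> \<in> borel_measurable borel" and le1: "\<And>z. \<theta> z \<le> 1" and "0 \<le> r"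
    and mass: "(\<integral>\<^sup>+ z. \<theta> z \<partial>lborel) = emeasure lborel (ball (0::'a) r)"
  shows "(\<integral>\<^sup>+ z. ennreal ((norm z)\<^sup>2) * indicator (ball (0::'a) r) z \<partial>lborel)
         \<le> (\<integral>\<^sup>+ z. ennreal ((norm z)\<^sup>2) * \<theta> z \<partial>lborel)"
proof -
  have pw: "ennreal ((norm z)\<^sup>2) * indicator (ball (0::'a) r) z + ennreal (r\<^sup>2) * \<theta> z
        \<le> ennreal ((norm z)\<^sup>2) * \<theta> z + ennreal (r\<^sup>2) * indicator (ball (0::'a) r) z" for z :: 'a
  proof -
    have "\<theta> z < top" using le1[of z] by (rule le_less_trans) simp
    then obtain s where s: "\<theta> z = ennreal s" "0 \<le> s" by (cases "\<theta> z") auto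
    with le1[of z] have "s \<le> 1" by (simp flip: ennreal_1)
    show ?thesis
    proof (cases "z \<in> ball 0 r")
      case True
      then have "(norm z)\<^sup>2 \<le> r\<^sup>2" by (intro power_mono) auto
      then have "(1 - s) * (norm z)\<^sup>2 \<le> (1 - s) * r\<^sup>2"
        using \<open>s \<le> 1\<close> by (intro mult_left_mono) auto
      then have "(norm z)\<^sup>2 + r\<^sup>2 * s \<le> (norm z)\<^sup>2 * s + r\<^sup>2" by (simp add: algebra_simps)
      with True s show ?thesis by (simp flip: ennreal_mult ennreal_plus)
    next
      case False
      then have "r\<^sup>2 \<le> (norm z)\<^sup>2" using \<open>0 \<le> r\<close> by (intro power_mono) auto
      then have "r\<^sup>2 * s \<le> (norm z)\<^sup>2 * s" using s by (intro mult_right_mono) auto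
      with False s show ?thesis by (simp flip: ennreal_mult ennreal_plus)
    qed
  qed
  have "(\<integral>\<^sup>+ z. ennreal ((norm z)\<^sup>2) * indicator (ball (0::'a) r) z \<partial>lborel) + ennreal (r\<^sup>2) * emeasure lborel (ball (0::'a) r)
      = (\<integral>\<^sup>+ z. ennreal ((norm z)\<^sup>2) * indicator (ball (0::'a) r) z + ennreal (r\<^sup>2) * \<theta> z \<partial>lborel)"
    by (simp add: nn_integral_add nn_integral_cmult mass)
  also have "\<dots> \<le> (\<integral>\<^sup>+ z. ennreal ((norm z)\<^sup>2) * \<theta> z + ennreal (r\<^sup>2) * indicator (ball (0::'a) r) z \<partial>lborel)"
    by (intro nn_integral_mono pw)
  also have "\<dots> = (\<integral>\<^sup>+ z. ennreal ((norm z)\<^sup>2) * \<theta> z \<partial>lborel) + ennreal (r\<^sup>2) * emeasure lborel (ball (0::'a) r)"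
    by (simp add: nn_integral_add nn_integral_cmult)
  finally show ?thesis
    using emeasure_lborel_ball_finite[of "0::'a" r]
    by (auto simp: add.commute[of _ "ennreal _ * _"] ennreal_add_left_cancel_le ennreal_mult_eq_top_iff)
qed

lemma emeasure_ball_dilate:
  fixes r s :: real
  assumes "0 \<le> r" "0 \<le> s"
  shows "emeasure lborel (ball (0::'a::euclidean_space) (s * r)) = ennreal (s ^ DIM('a)) * emeasure lborel (ball (0::'a) r)"
  using assms by (simp add: emeasure_ball power_mult_distrib mult_ac flip: ennreal_mult)

text \<open>Volume contributes s^n and the integrand s^2. For s = 1 + t the first factor is the mass
  normalisation in \<open>cell_coupling\<close> and cancels; the second is the gain that drives the
  proof.\<close>

lemma second_moment_ball_dilate:
  fixes r s :: real
  assumes "0 \<le> r" "0 < s"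
  shows "(\<integral>\<^sup>+ z. ennreal ((norm z)\<^sup>2) * indicator (ball (0::'a::euclidean_space) (s * r)) z \<partial>lborel)
     = ennreal (s ^ DIM('a)) * ennreal (s\<^sup>2) * (\<integral>\<^sup>+ z. ennreal ((norm z)\<^sup>2) * indicator (ball (0::'a) r) z \<partial>lborel)"
proof -
  have ind: "indicator (ball (0::'a) (s * r)) (s *\<^sub>R z) = (indicator (ball 0 r) z :: ennreal)" for z
    using assms by (auto simp: indicator_def abs_mult)
  have "(\<integral>\<^sup>+ z. ennreal ((norm z)\<^sup>2) * indicator (ball (0::'a) (s * r)) z \<partial>lborel)
     = (\<integral>\<^sup>+ z. ennreal ((norm z)\<^sup>2) * indicator (ball (0::'a) (s * r)) z
          \<partial>density (distr lborel borel (\<lambda>x. 0 + s *\<^sub>R x)) (\<lambda>_. \<bar>s\<bar> ^ DIM('a)))"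
    using assms by (subst lborel_affine[of s 0]) auto
  also have "\<dots> = (\<integral>\<^sup>+ z. ennreal (s ^ DIM('a)) * (ennreal (s\<^sup>2) * (ennreal ((norm z)\<^sup>2) * indicator (ball (0::'a) r) z)) \<partial>lborel)"
    using assms
    by (subst nn_integral_density; (subst nn_integral_distr)?)
       (auto intro!: nn_integral_cong borel_measurable_times_ennreal borel_measurable_indicator
          simp: ind power_mult_distrib ennreal_mult mult.assoc)
  also have "\<dots> = ennreal (s ^ DIM('a)) * ennreal (s\<^sup>2) * (\<integral>\<^sup>+ z. ennreal ((norm z)\<^sup>2) * indicator (ball (0::'a) r) z \<partial>lborel)"
    by (simp add: nn_integral_cmult mult.assoc)
  finally show ?thesis .
qed

text \<open>This is where the Brunn--Minkowski inequality for two parallel boxes enters.\<close>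

lemma prod_affine_ge:
  fixes p q :: "'i \<Rightarrow> real" and t m :: real
  assumes "finite I" and pos: "0 < t" "0 < m"
    and p: "\<And>i. i \<in> I \<Longrightarrow> 0 \<le> p i" "m \<le> (\<Prod>i\<in>I. p i)"
    and q: "\<And>i. i \<in> I \<Longrightarrow> 0 \<le> q i" "m \<le> (\<Prod>i\<in>I. q i)"
  shows "(1 + t) ^ card I * m \<le> (\<Prod>i\<in>I. t * p i + q i)"
proof -
  \<comment> \<open>These weights sum to 1 and satisfy t p + q = (1 + t) (\<alpha> p + \<beta> q),
    so each side is a weighted arithmetic mean, to be compared with the geometric one.\<close>
  define \<alpha> where "\<alpha> = t / (1 + t)"
  define \<beta> where "\<beta> = 1 / (1 + t)"
  have ab: "0 < \<alpha>" "0 < \<beta>" "\<alpha> + \<beta> = 1"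
    using pos by (auto simp: \<alpha>_def \<beta>_def field_simps)
  \<comment> \<open>Young's inequality is used for positive numbers; a side cannot vanish because
    the product is at least m > 0.\<close>
  have p': "0 < p i" if "i \<in> I" for i
    using p(1)[OF that] p(2) pos(2) that \<open>finite I\<close>
    by (metis less_eq_real_def not_le prod_zero_iff)
  have q': "0 < q i" if "i \<in> I" for i
    using q(1)[OF that] q(2) pos(2) that \<open>finite I\<close>
    by (metis less_eq_real_def not_le prod_zero_iff)
  have "m = m powr \<alpha> * m powr \<beta>"
    using ab pos by (simp flip: powr_add)
  also have "\<dots> \<le> (\<Prod>i\<in>I. p i) powr \<alpha> * (\<Prod>i\<in>I. q i) powr \<beta>"
    using ab pos p(2) q(2) by (intro mult_mono powr_mono2) auto
  also have "\<dots> = (\<Prod>i\<in>I. p i powr \<alpha> * q i powr \<beta>)"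
    using p(1) q(1) by (simp add: prod.distrib prod_powr_distrib)
  also have "\<dots> \<le> (\<Prod>i\<in>I. \<alpha> * p i + \<beta> * q i)"
    using ab p' q' by (intro prod_mono conjI Youngs_inequality_0 mult_nonneg_nonneg) auto
  finally have "(1 + t) ^ card I * m \<le> (1 + t) ^ card I * (\<Prod>i\<in>I. \<alpha> * p i + \<beta> * q i)"
    using pos by (intro mult_left_mono) auto
  also have "\<dots> = (\<Prod>i\<in>I. (1 + t) * (\<alpha> * p i + \<beta> * q i))"
    by (simp add: prod.distrib)
  also have "\<dots> = (\<Prod>i\<in>I. t * p i + q i)"
    using pos by (simp add: \<alpha>_def \<beta>_def distrib_left mult.assoc[symmetric])
  finally show ?thesis .
qed

section \<open>Pairs of pieces in parallel boxes\<close>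

text \<open>A piece of a set is carried as a function with an enclosing box: a cut multiplies the
  function by the indicator of a half-space and shrinks the box. The bound by 1 makes the mass at
  most the volume of the box, which links mass to side lengths.\<close>

definition box_density :: "'a::euclidean_space \<Rightarrow> 'a \<Rightarrow> ('a \<Rightarrow> ennreal) \<Rightarrow> bool" where
  "box_density a b f \<longleftrightarrow>
     f \<in> borel_measurable borel \<and> (\<forall>x. f x \<le> 1) \<and> (\<forall>x. x \<notin> cbox a b \<longrightarrow> f x = 0)"

lemma box_density_mass_le:
  assumes "box_density a b f"
  shows "(\<integral>\<^sup>+ x. f x \<partial>lborel) \<le> emeasure lborel (cbox a b)"
proof -
  have "(\<integral>\<^sup>+ x. f x \<partial>lborel) \<le> (\<integral>\<^sup>+ x. indicator (cbox a b) x \<partial>lborel)"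
    using assms by (intro nn_integral_mono) (auto simp: box_density_def indicator_def)
  then show ?thesis by simp
qed

text \<open>
  \<open>\<theta>\<close> stands for the rescaled law of \<open>t x + y\<close>, smeared uniformly over each cell; \<open>\<eta>\<close>
  absorbs the diameter of a cell. Requiring \<open>\<theta>\<close> to vanish off \<open>Z\<close> keeps the bound
  \<open>\<theta> \<le> 1\<close> under unions of disjoint cells.
\<close>

definition cell_coupling ::
  "real \<Rightarrow> real \<Rightarrow> 'a::euclidean_space set \<Rightarrow> ('a \<Rightarrow> ennreal) \<Rightarrow> ('a \<Rightarrow> ennreal) \<Rightarrow> bool" where
  "cell_coupling t \<eta> Z f g \<longleftrightarrow> (\<exists>k \<theta>. coupling_density f g k \<and>
     \<theta> \<in> borel_measurable borel \<and> (\<forall>z. \<theta> z \<le> 1) \<and> (\<forall>z. z \<notin> Z \<longrightarrow> \<theta> z = 0) \<and>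
     (\<integral>\<^sup>+ z. \<theta> z \<partial>lborel) = ennreal ((1 + t) ^ DIM('a)) * (\<integral>\<^sup>+ x. f x \<partial>lborel) \<and>
     (\<integral>\<^sup>+ z. ennreal ((norm z)\<^sup>2) * \<theta> z \<partial>lborel)
       \<le> ennreal ((1 + t) ^ DIM('a)) *
          (\<integral>\<^sup>+ z. ennreal ((norm (t *\<^sub>R fst z + snd z) + \<eta>)\<^sup>2) * k z \<partial>(lborel \<Otimes>\<^sub>M lborel)))"

lemma cell_coupling_add:
  fixes Z :: "'a::euclidean_space set"
  assumes 1: "cell_coupling t \<eta> Z\<^sub>1 f\<^sub>1 g\<^sub>1" and 2: "cell_coupling t \<eta> Z\<^sub>2 f\<^sub>2 g\<^sub>2"
    and Z: "Z\<^sub>1 \<inter> Z\<^sub>2 = {}" "Z\<^sub>1 \<subseteq> Z" "Z\<^sub>2 \<subseteq> Z"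
    and [measurable]: "f\<^sub>1 \<in> borel_measurable borel" "f\<^sub>2 \<in> borel_measurable borel"
  shows "cell_coupling t \<eta> Z (\<lambda>x. f\<^sub>1 x + f\<^sub>2 x) (\<lambda>x. g\<^sub>1 x + g\<^sub>2 x)"
proof -
  from 1 obtain k\<^sub>1 \<theta>\<^sub>1 where k1: "coupling_density f\<^sub>1 g\<^sub>1 k\<^sub>1"
    and [measurable]: "\<theta>\<^sub>1 \<in> borel_measurable borel"
    and th1: "\<And>z. \<theta>\<^sub>1 z \<le> 1" "\<And>z. z \<notin> Z\<^sub>1 \<Longrightarrow> \<theta>\<^sub>1 z = 0"
    "(\<integral>\<^sup>+ z. \<theta>\<^sub>1 z \<partial>lborel) = ennreal ((1 + t) ^ DIM('a)) * (\<integral>\<^sup>+ x. f\<^sub>1 x \<partial>lborel)"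
    "(\<integral>\<^sup>+ z. ennreal ((norm z)\<^sup>2) * \<theta>\<^sub>1 z \<partial>lborel) \<le> ennreal ((1 + t) ^ DIM('a)) *
          (\<integral>\<^sup>+ z. ennreal ((norm (t *\<^sub>R fst z + snd z) + \<eta>)\<^sup>2) * k\<^sub>1 z \<partial>(lborel \<Otimes>\<^sub>M lborel))"
    unfolding cell_coupling_def by blast
  from 2 obtain k\<^sub>2 \<theta>\<^sub>2 where k2: "coupling_density f\<^sub>2 g\<^sub>2 k\<^sub>2"
    and [measurable]: "\<theta>\<^sub>2 \<in> borel_measurable borel"
    and th2: "\<And>z. \<theta>\<^sub>2 z \<le> 1" "\<And>z. z \<notin> Z\<^sub>2 \<Longrightarrow> \<theta>\<^sub>2 z = 0"
    "(\<integral>\<^sup>+ z. \<theta>\<^sub>2 z \<partial>lborel) = ennreal ((1 + t) ^ DIM('a)) * (\<integral>\<^sup>+ x. f\<^sub>2 x \<partial>lborel)"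
    "(\<integral>\<^sup>+ z. ennreal ((norm z)\<^sup>2) * \<theta>\<^sub>2 z \<partial>lborel) \<le> ennreal ((1 + t) ^ DIM('a)) *
          (\<integral>\<^sup>+ z. ennreal ((norm (t *\<^sub>R fst z + snd z) + \<eta>)\<^sup>2) * k\<^sub>2 z \<partial>(lborel \<Otimes>\<^sub>M lborel))"
    unfolding cell_coupling_def by blast
  note [measurable] = k1[THEN coupling_density_measurable] k2[THEN coupling_density_measurable]
  have "\<theta>\<^sub>1 z + \<theta>\<^sub>2 z \<le> 1" for z
    using th1(1,2)[of z] th2(1,2)[of z] Z(1) by (cases "z \<in> Z\<^sub>1"; cases "z \<in> Z\<^sub>2") auto
  moreover have "\<theta>\<^sub>1 z + \<theta>\<^sub>2 z = 0" if "z \<notin> Z" for z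
    using that Z th1(2)[of z] th2(2)[of z] by auto
  moreover have "(\<integral>\<^sup>+ z. \<theta>\<^sub>1 z + \<theta>\<^sub>2 z \<partial>lborel) = ennreal ((1 + t) ^ DIM('a)) * (\<integral>\<^sup>+ x. f\<^sub>1 x + f\<^sub>2 x \<partial>lborel)"
    by (simp add: nn_integral_add th1 th2 distrib_left)
  moreover have "(\<integral>\<^sup>+ z. ennreal ((norm z)\<^sup>2) * (\<theta>\<^sub>1 z + \<theta>\<^sub>2 z) \<partial>lborel) \<le> ennreal ((1 + t) ^ DIM('a)) *
          (\<integral>\<^sup>+ z. ennreal ((norm (t *\<^sub>R fst z + snd z) + \<eta>)\<^sup>2) * (k\<^sub>1 z + k\<^sub>2 z) \<partial>(lborel \<Otimes>\<^sub>M lborel))"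
    using add_mono[OF th1(4) th2(4)]
    by (simp add: nn_integral_add distrib_left)
  ultimately show ?thesis
    using coupling_density_add[OF k1 k2] unfolding cell_coupling_def
    by (intro exI[of _ "\<lambda>z. k\<^sub>1 z + k\<^sub>2 z"] exI[of _ "\<lambda>z. \<theta>\<^sub>1 z + \<theta>\<^sub>2 z"]) auto
qed

lemma cell_coupling_null:
  fixes f g :: "'a::euclidean_space \<Rightarrow> ennreal"
  assumes [measurable]: "f \<in> borel_measurable borel" "g \<in> borel_measurable borel"
    and "(\<integral>\<^sup>+ x. f x \<partial>lborel) = 0" "(\<integral>\<^sup>+ x. g x \<partial>lborel) = 0"
  shows "cell_coupling t \<eta> Z f g"
  using assms coupling_density_product[of f g 0] unfolding cell_coupling_def
  by (intro exI[of _ "\<lambda>z. f (fst z) * g (snd z) / 0"] exI[of _ "\<lambda>_. 0"]) auto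

text \<open>The product coupling works for small boxes P and Q: all points t x + y lie in the
  closure of the box t P + Q, whose sides are at most (1 + t) \<delta>. Spreading the mass uniformly
  over that box therefore changes the norm by at most \<eta>, and its volume bounds the constant
  height of \<open>\<theta>\<close> by 1.\<close>

lemma cell_coupling_small_boxes:
  fixes a b a' b' :: "'a::euclidean_space" and t \<delta> \<eta> :: real
  assumes f: "box_density a b f" and g: "box_density a' b' g"
    and mass: "(\<integral>\<^sup>+ x. f x \<partial>lborel) = (\<integral>\<^sup>+ x. g x \<partial>lborel)"
    and le: "\<And>i. i \<in> Basis \<Longrightarrow> a \<bullet> i \<le> b \<bullet> i" "\<And>i. i \<in> Basis \<Longrightarrow> a' \<bullet> i \<le> b' \<bullet> i"
    and small: "\<And>i. i \<in> Basis \<Longrightarrow> (b - a) \<bullet> i \<le> \<delta>" "\<And>i. i \<in> Basis \<Longrightarrow> (b' - a') \<bullet> i \<le> \<delta>"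
    and t: "0 < t" and \<eta>: "DIM('a) * ((1 + t) * \<delta>) \<le> \<eta>"
  shows "cell_coupling t \<eta> (box (t *\<^sub>R a + a') (t *\<^sub>R b + b')) f g"
proof (cases "(\<integral>\<^sup>+ x. f x \<partial>lborel) = 0")
  case True
  with f g mass show ?thesis by (intro cell_coupling_null) (auto simp: box_density_def)
next
  case False
  have [measurable]: "f \<in> borel_measurable borel" "g \<in> borel_measurable borel"
    using f g by (auto simp: box_density_def)
  let ?Z = "box (t *\<^sub>R a + a') (t *\<^sub>R b + b')"
  define T where "T = (1 + t) ^ DIM('a)"
  have T: "0 < T" using t by (simp add: T_def)
  have fin: "(\<integral>\<^sup>+ x. f x \<partial>lborel) < \<infinity>"
    using box_density_mass_le[OF f] emeasure_lborel_cbox_finite by (rule le_less_trans)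
  then obtain m where m: "(\<integral>\<^sup>+ x. f x \<partial>lborel) = ennreal m" "0 \<le> m"
    by (cases "(\<integral>\<^sup>+ x. f x \<partial>lborel)") auto
  with False have "0 < m" by (auto simp: order_le_less)
  have "ennreal m \<le> ennreal (\<Prod>i\<in>Basis. (b - a) \<bullet> i)"
    using box_density_mass_le[OF f] le(1) by (simp add: m)
  then have mp: "m \<le> (\<Prod>i\<in>Basis. (b - a) \<bullet> i)"
    using le(1) by (subst (asm) ennreal_le_iff) (auto intro!: prod_nonneg simp: inner_diff_left)
  have "ennreal m \<le> ennreal (\<Prod>i\<in>Basis. (b' - a') \<bullet> i)"
    using box_density_mass_le[OF g] le(2) by (simp add: m flip: mass)
  then have mq: "m \<le> (\<Prod>i\<in>Basis. (b' - a') \<bullet> i)"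
    using le(2) by (subst (asm) ennreal_le_iff) (auto intro!: prod_nonneg simp: inner_diff_left)
  \<comment> \<open>The volume of t P + Q. Since \<open>\<theta>\<close> will be the constant T m /
    v on this box, the estimate T m \<le> v is the same as \<theta> \<le> 1.\<close>
  define v where "v = (\<Prod>i\<in>Basis. t * ((b - a) \<bullet> i) + (b' - a') \<bullet> i)"
  have v: "T * m \<le> v"
    unfolding v_def T_def
    by (rule prod_affine_ge) (use t \<open>0 < m\<close> mp mq le in \<open>auto simp: inner_diff_left\<close>)
  with T \<open>0 < m\<close> have "0 < v" by (meson less_le_trans mult_pos_pos)
  have vZ: "emeasure lborel ?Z = ennreal v"
    unfolding v_def using le t
    by (subst emeasure_lborel_box)
      (auto simp: inner_simps algebra_simps intro!: arg_cong[where f=ennreal] prod.cong add_mono mult_left_mono)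
  define k where "k = (\<lambda>z. f (fst z) * g (snd z) / ennreal m)"
  define \<theta> where "\<theta> = (\<lambda>z. ennreal (T * m / v) * indicator ?Z z)"
  have [measurable]: "\<theta> \<in> borel_measurable borel" by (simp add: \<theta>_def)
  have k: "coupling_density f g k"
    unfolding k_def using m mass by (intro coupling_density_product) auto
  note [measurable] = coupling_density_measurable[OF k]
  have th: "(\<integral>\<^sup>+ z. \<theta> z \<partial>lborel) = ennreal T * ennreal m"
    using T \<open>0 < v\<close> \<open>0 < m\<close> by (simp add: \<theta>_def nn_integral_cmult vZ flip: ennreal_mult)
  let ?J = "\<integral>\<^sup>+ z. ennreal ((norm (t *\<^sub>R fst z + snd z) + \<eta>)\<^sup>2) * k z \<partial>(lborel \<Otimes>\<^sub>M lborel)"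
  \<comment> \<open>For each fixed z in the cell, every coupled t x + y has norm at least |z| -
    \<eta>. Averaging this pointwise bound against \<open>\<theta>\<close>, of total mass T m, gives
    the moment inequality.\<close>
  have J: "ennreal ((norm z)\<^sup>2) * ennreal m \<le> ?J" if "z \<in> ?Z" for z
  proof -
    have "ennreal ((norm z)\<^sup>2) * ennreal m = (\<integral>\<^sup>+ w. ennreal ((norm z)\<^sup>2) * k w \<partial>(lborel \<Otimes>\<^sub>M lborel))"
      by (simp add: nn_integral_cmult coupling_density_mass[OF k] m)
    also have "\<dots> \<le> ?J"
    proof (rule nn_integral_mono)
      fix w :: "'a \<times> 'a"
      show "ennreal ((norm z)\<^sup>2) * k w \<le> ennreal ((norm (t *\<^sub>R fst w + snd w) + \<eta>)\<^sup>2) * k w"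
      proof (cases "k w = 0")
        case False
        then have "f (fst w) \<noteq> 0" "g (snd w) \<noteq> 0" by (auto simp: k_def)
        then have w: "fst w \<in> cbox a b" "snd w \<in> cbox a' b'"
          using f g unfolding box_density_def by blast+
        let ?u = "t *\<^sub>R fst w + snd w"
        \<comment> \<open>Both coordinates lie in the same closed interval, a side of t P + Q;
          adding the n coordinate bounds produces the constant n (1 + t) \<delta> required of
          \<eta>.\<close>
        have "\<bar>(z - ?u) \<bullet> i\<bar> \<le> (1 + t) * \<delta>" if i: "i \<in> Basis" for i
        proof -
          have 1: "t * (a \<bullet> i) \<le> t * (fst w \<bullet> i)" "t * (fst w \<bullet> i) \<le> t * (b \<bullet> i)"
            using w i t by (auto simp: mem_box intro!: mult_left_mono)
          have 2: "a' \<bullet> i \<le> snd w \<bullet> i" "snd w \<bullet> i \<le> b' \<bullet> i"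
            using w i by (auto simp: mem_box)
          have 3: "t * (a \<bullet> i) + a' \<bullet> i < z \<bullet> i" "z \<bullet> i < t * (b \<bullet> i) + b' \<bullet> i"
            using \<open>z \<in> ?Z\<close> i by (auto simp: mem_box inner_simps)
          have "t * (b \<bullet> i) - t * (a \<bullet> i) \<le> t * \<delta>"
            using mult_left_mono[OF small(1)[OF i], of t] t by (simp add: inner_simps algebra_simps)
          moreover have "b' \<bullet> i - a' \<bullet> i \<le> \<delta>" using small(2)[OF i] by (simp add: inner_simps)
          ultimately show ?thesis using 1 2 3 by (simp add: inner_simps algebra_simps)
        qed
        then have "norm (z - ?u) \<le> (\<Sum>i\<in>(Basis::'a set). (1 + t) * \<delta>)"
          by (intro order_trans[OF norm_le_l1] sum_mono)
        then have "norm z \<le> norm ?u + \<eta>"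
          using \<eta> norm_triangle_sub[of z ?u] by simp
        then show ?thesis
          by (intro mult_right_mono ennreal_leI power_mono) auto
      qed simp
    qed
    finally show ?thesis .
  qed
  have "ennreal ((norm z)\<^sup>2) * \<theta> z \<le> ?J / ennreal m * \<theta> z" for z
  proof (cases "z \<in> ?Z")
    case True
    have "ennreal ((norm z)\<^sup>2) = ennreal ((norm z)\<^sup>2) * ennreal m / ennreal m"
      using \<open>0 < m\<close> by (simp flip: ennreal_mult add: divide_ennreal)
    also have "\<dots> \<le> ?J / ennreal m" by (rule divide_right_mono_ennreal) (rule J[OF True])
    finally show ?thesis by (intro mult_right_mono) auto
  qed (simp add: \<theta>_def)
  then have "(\<integral>\<^sup>+ z. ennreal ((norm z)\<^sup>2) * \<theta> z \<partial>lborel) \<le> (\<integral>\<^sup>+ z. ?J / ennreal m * \<theta> z \<partial>lborel)"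
    by (rule nn_integral_mono)
  also have "\<dots> = ?J / ennreal m * (ennreal T * ennreal m)" by (simp add: nn_integral_cmult th)
  also have "\<dots> = ennreal T * (?J / ennreal m * ennreal m)" by (simp add: mult_ac)
  also have "?J / ennreal m * ennreal m = ?J"
    using \<open>0 < m\<close> by (simp add: ennreal_divide_times ennreal_times_divide[symmetric] ennreal_divide_self)
  finally have "(\<integral>\<^sup>+ z. ennreal ((norm z)\<^sup>2) * \<theta> z \<partial>lborel) \<le> ennreal T * ?J" .
  moreover have "\<theta> z \<le> 1" for z
    using v \<open>0 < v\<close> T \<open>0 < m\<close> by (auto simp: \<theta>_def indicator_def)
  moreover have "\<theta> z = 0" if "z \<notin> ?Z" for z using that by (simp add: \<theta>_def)
  ultimately show ?thesis
    using k th m unfolding cell_coupling_def T_def by (intro exI[of _ k] exI[of _ \<theta>]) auto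
qed

section \<open>Cutting two boxes in the same proportion of mass\<close>

text \<open>Hyperplanes are null sets, so the law \<open>M\<close> of the i-th coordinate has no
  atoms and its distribution function is continuous. It runs from 0 at the lower face of the box to
  the full mass at the upper face, and the intermediate value theorem supplies the cut.\<close>

lemma box_density_cut:
  fixes a b :: "'a::euclidean_space"
  assumes f: "box_density a b f" and i: "i \<in> Basis" and ab: "a \<bullet> i \<le> b \<bullet> i"
    and m: "m \<le> (\<integral>\<^sup>+ x. f x \<partial>lborel)"
  obtains c where "a \<bullet> i \<le> c" "c \<le> b \<bullet> i" "(\<integral>\<^sup>+ x. f x * indicator {x. x \<bullet> i \<le> c} x \<partial>lborel) = m"
proof -
  have [measurable]: "f \<in> borel_measurable borel" using f by (simp add: box_density_def)
  define M where "M = distr (density lborel f) borel (\<lambda>x. x \<bullet> i)"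
  have em: "emeasure M A = (\<integral>\<^sup>+ x. f x * indicator {x. x \<bullet> i \<in> A} x \<partial>lborel)" if [measurable]: "A \<in> sets borel" for A
  proof -
    have "emeasure M A = emeasure (density lborel f) {x. x \<bullet> i \<in> A}"
      unfolding M_def by (subst emeasure_distr) (auto simp: vimage_def)
    then show ?thesis by (subst (asm) emeasure_density) auto
  qed
  have total: "emeasure M UNIV = (\<integral>\<^sup>+ x. f x \<partial>lborel)" by (simp add: em)
  have fin: "(\<integral>\<^sup>+ x. f x \<partial>lborel) < \<infinity>"
    using box_density_mass_le[OF f] emeasure_lborel_cbox_finite by (rule le_less_trans)
  have sp: "space M = UNIV" and st: "sets M = sets borel" by (simp_all add: M_def)
  have "finite_measure M"
    using total fin sp by (intro finite_measureI) auto
  then interpret finite_borel_measure M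
    using st by (intro finite_borel_measure.intro finite_borel_measure_axioms.intro)
  have hyper: "AE x in lborel. x \<bullet> i \<noteq> c" for c
  proof -
    have "{x. x \<bullet> i = c} \<in> null_sets lborel"
      using negligible_standard_hyperplane[OF i, of c]
      by (simp add: negligible_iff_null_sets null_sets_completion_iff borel_closed closed_hyperplane inner_commute)
    then show ?thesis by (auto simp: AE_iff_null_sets[symmetric] dest: AE_not_in)
  qed
  have "emeasure M {c} = 0" for c
    using hyper[of c] by (simp add: em nn_integral_0_iff_AE) (auto elim!: AE_mp)
  then have cont: "isCont (cdf M) c" for c by (simp add: isCont_cdf measure_def)
  have "emeasure M {.. a \<bullet> i} = 0"
  proof -
    have "f x * indicator {x. x \<bullet> i \<in> {..a \<bullet> i}} x = 0" if "x \<bullet> i \<noteq> a \<bullet> i" for x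
    proof (cases "x \<bullet> i \<le> a \<bullet> i")
      case True
      with that i have "x \<notin> cbox a b" by (force simp: mem_box)
      with f show ?thesis by (simp add: box_density_def)
    qed simp
    then have "AE x in lborel. f x * indicator {x. x \<bullet> i \<in> {..a \<bullet> i}} x = 0"
      using hyper[of "a \<bullet> i"] by (auto elim!: AE_mp)
    then show ?thesis
      by (subst em) (auto simp: nn_integral_0_iff_AE)
  qed
  then have lo: "cdf M (a \<bullet> i) = 0" by (simp add: cdf_def measure_def)
  have "emeasure M {.. b \<bullet> i} = (\<integral>\<^sup>+ x. f x \<partial>lborel)"
    unfolding em[OF borel_closed[OF closed_atMost]]
    using f i by (intro nn_integral_cong) (auto simp: box_density_def mem_box indicator_def)
  then have hi: "cdf M (b \<bullet> i) = enn2real (\<integral>\<^sup>+ x. f x \<partial>lborel)" by (simp add: cdf_def measure_def)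
  have "\<exists>c\<ge>a \<bullet> i. c \<le> b \<bullet> i \<and> cdf M c = enn2real m"
  proof (rule IVT)
    show "cdf M (a \<bullet> i) \<le> enn2real m" by (simp add: lo)
    show "enn2real m \<le> cdf M (b \<bullet> i)" unfolding hi using m fin by (intro enn2real_mono) auto
  qed (use ab cont in auto)
  then obtain c where c: "a \<bullet> i \<le> c" "c \<le> b \<bullet> i" "cdf M c = enn2real m" by blast
  have "m < \<infinity>" using m fin by (rule le_less_trans)
  then have "emeasure M {..c} = m"
    using c(3) by (simp add: emeasure_eq_measure cdf_def)
  with c that show ?thesis by (simp add: em)
qed

text \<open>
  Both boxes are cut by parallel hyperplanes in the same proportion of mass, so the Minkowski
  sums of the resulting pieces stay disjoint. Every cut removes at least \<open>\<delta> / 2\<close> from the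
  total side length.
\<close>

lemma cell_coupling_boxes_aux:
  fixes a b a' b' :: "'a::euclidean_space" and t \<delta> \<eta> :: real and N :: nat
  assumes t: "0 < t" and \<delta>: "0 < \<delta>" and \<eta>: "DIM('a) * ((1 + t) * \<delta>) \<le> \<eta>"
    and "box_density a b f" "box_density a' b' g"
    and "(\<integral>\<^sup>+ x. f x \<partial>lborel) = (\<integral>\<^sup>+ x. g x \<partial>lborel)"
    and "\<And>i. i \<in> Basis \<Longrightarrow> a \<bullet> i \<le> b \<bullet> i" "\<And>i. i \<in> Basis \<Longrightarrow> a' \<bullet> i \<le> b' \<bullet> i"
    and "(\<Sum>i\<in>Basis. (b - a) \<bullet> i + (b' - a') \<bullet> i) \<le> N * (\<delta> / 2)"
  shows "cell_coupling t \<eta> (box (t *\<^sub>R a + a') (t *\<^sub>R b + b')) f g"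
  using assms(4-)
proof (induction N arbitrary: a b a' b' f g)
  case 0
  \<comment> \<open>With no cuts left, the sides, all nonnegative, have sum at most zero.\<close>
  have small: "(b - a) \<bullet> i + (b' - a') \<bullet> i \<le> 0" if "i \<in> Basis" for i
    using member_le_sum[OF that, of "\<lambda>i. (b - a) \<bullet> i + (b' - a') \<bullet> i"] 0(4-6)
    by (simp add: inner_diff_left add_nonneg_nonneg)
  show ?case
  proof (rule cell_coupling_small_boxes[OF 0(1,2,3,4,5) _ _ t \<eta>])
    fix i :: 'a assume i: "i \<in> Basis"
    show "(b - a) \<bullet> i \<le> \<delta>" "(b' - a') \<bullet> i \<le> \<delta>"
      using small[OF i] 0(4,5)[OF i] \<delta> by (auto simp: inner_diff_left)
  qed
next
  case (Suc N)
  note f = Suc.prems(1) and g = Suc.prems(2) and mass = Suc.prems(3) and le = Suc.prems(4,5)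
  show ?case
  proof (cases "\<forall>i\<in>Basis. (b - a) \<bullet> i \<le> \<delta> \<and> (b' - a') \<bullet> i \<le> \<delta>")
    case True
    then show ?thesis
      by (intro cell_coupling_small_boxes[OF f g mass le _ _ t \<eta>]) auto
  next
    case False
    then obtain i where i: "i \<in> Basis" and long: "\<delta> < (b - a) \<bullet> i \<or> \<delta> < (b' - a') \<bullet> i"
      by force
    have lf: "(\<integral>\<^sup>+ x. f x * indicator {x. x \<bullet> i \<le> c} x \<partial>lborel) \<le> (\<integral>\<^sup>+ x. f x \<partial>lborel)" for c
      by (intro nn_integral_mono) (auto simp: indicator_def)
    have lg: "(\<integral>\<^sup>+ x. g x * indicator {x. x \<bullet> i \<le> c} x \<partial>lborel) \<le> (\<integral>\<^sup>+ x. g x \<partial>lborel)" for c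
      by (intro nn_integral_mono) (auto simp: indicator_def)
    \<comment> \<open>A side longer than \<delta> is halved, so each half loses at least \<delta> /
      2 there. The other box is cut wherever the masses match; that cut may touch a face, but it
      never lengthens a side.\<close>
    obtain c c' where c: "a \<bullet> i \<le> c" "c \<le> b \<bullet> i" "a' \<bullet> i \<le> c'" "c' \<le> b' \<bullet> i"
      and cm: "(\<integral>\<^sup>+ x. f x * indicator {x. x \<bullet> i \<le> c} x \<partial>lborel)
        = (\<integral>\<^sup>+ x. g x * indicator {x. x \<bullet> i \<le> c'} x \<partial>lborel)"
      and short: "\<delta> / 2 \<le> (b \<bullet> i - c) + (b' \<bullet> i - c')" "\<delta> / 2 \<le> (c - a \<bullet> i) + (c' - a' \<bullet> i)"
    proof (cases "\<delta> < (b - a) \<bullet> i")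
      case True
      define c where "c = (a \<bullet> i + b \<bullet> i) / 2"
      obtain c' where "a' \<bullet> i \<le> c'" "c' \<le> b' \<bullet> i"
        "(\<integral>\<^sup>+ x. g x * indicator {x. x \<bullet> i \<le> c'} x \<partial>lborel) = (\<integral>\<^sup>+ x. f x * indicator {x. x \<bullet> i \<le> c} x \<partial>lborel)"
        using box_density_cut[OF g i le(2)[OF i] lf[unfolded mass]] by blast
      with True le(1)[OF i] show ?thesis
        by (intro that[of c c']) (auto simp: c_def inner_diff_left field_simps)
    next
      case False
      define c' where "c' = (a' \<bullet> i + b' \<bullet> i) / 2"
      obtain c where "a \<bullet> i \<le> c" "c \<le> b \<bullet> i"
        "(\<integral>\<^sup>+ x. f x * indicator {x. x \<bullet> i \<le> c} x \<partial>lborel) = (\<integral>\<^sup>+ x. g x * indicator {x. x \<bullet> i \<le> c'} x \<partial>lborel)"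
        using box_density_cut[OF f i le(1)[OF i] lg[unfolded mass[symmetric]]] by blast
      with False long le(2)[OF i] show ?thesis
        by (intro that[of c c']) (auto simp: c'_def inner_diff_left field_simps)
    qed
    have [measurable]: "f \<in> borel_measurable borel" "g \<in> borel_measurable borel"
      using f g by (auto simp: box_density_def)
    \<comment> \<open>The lower halves end at \<open>bl\<close> and \<open>bl'\<close>, the upper
      halves begin at \<open>au\<close> and \<open>au'\<close>; only the i-th coordinate
      moves.\<close>
    define bl where "bl = b + (c - b \<bullet> i) *\<^sub>R i"
    define bl' where "bl' = b' + (c' - b' \<bullet> i) *\<^sub>R i"
    define au where "au = a + (c - a \<bullet> i) *\<^sub>R i"
    define au' where "au' = a' + (c' - a' \<bullet> i) *\<^sub>R i"
    have comp: "bl \<bullet> j = (if j = i then c else b \<bullet> j)" "bl' \<bullet> j = (if j = i then c' else b' \<bullet> j)"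
      "au \<bullet> j = (if j = i then c else a \<bullet> j)" "au' \<bullet> j = (if j = i then c' else a' \<bullet> j)"
      if "j \<in> Basis" for j
      using that i by (auto simp: bl_def bl'_def au_def au'_def inner_simps inner_Basis)
    have sumi: "(\<Sum>j\<in>Basis. x * (i \<bullet> j)) = x" for x :: real
      using i by (simp add: inner_Basis sum.delta' if_distrib cong: if_cong)
    let ?lf = "\<lambda>x. f x * indicator {x. x \<bullet> i \<le> c} x" and ?uf = "\<lambda>x. f x * indicator {x. c < x \<bullet> i} x"
    let ?lg = "\<lambda>x. g x * indicator {x. x \<bullet> i \<le> c'} x" and ?ug = "\<lambda>x. g x * indicator {x. c' < x \<bullet> i} x"
    have splitf: "(\<lambda>x. ?lf x + ?uf x) = f" and splitg: "(\<lambda>x. ?lg x + ?ug x) = g"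
      by (auto simp: fun_eq_iff indicator_def)
    have bd: "box_density a bl ?lf" "box_density au b ?uf" "box_density a' bl' ?lg" "box_density au' b' ?ug"
    proof -
      have "x \<in> cbox a bl" if "x \<in> cbox a b" "x \<bullet> i \<le> c" for x
        using that by (simp add: mem_box comp)
      moreover have "x \<in> cbox au b" if "x \<in> cbox a b" "c < x \<bullet> i" for x
        using that by (simp add: mem_box comp)
      moreover have "x \<in> cbox a' bl'" if "x \<in> cbox a' b'" "x \<bullet> i \<le> c'" for x
        using that by (simp add: mem_box comp)
      moreover have "x \<in> cbox au' b'" if "x \<in> cbox a' b'" "c' < x \<bullet> i" for x
        using that by (simp add: mem_box comp)
      moreover have "?lf \<in> borel_measurable borel" "?uf \<in> borel_measurable borel"
        "?lg \<in> borel_measurable borel" "?ug \<in> borel_measurable borel"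
        by measurable
      ultimately show "box_density a bl ?lf" "box_density au b ?uf" "box_density a' bl' ?lg" "box_density au' b' ?ug"
        using f g unfolding box_density_def by (fastforce simp: indicator_def)+
    qed
    have fin: "(\<integral>\<^sup>+ x. ?lf x \<partial>lborel) < \<infinity>"
      using box_density_mass_le[OF bd(1)] emeasure_lborel_cbox_finite by (rule le_less_trans)
    have "(\<integral>\<^sup>+ x. ?lf x \<partial>lborel) + (\<integral>\<^sup>+ x. ?uf x \<partial>lborel) = (\<integral>\<^sup>+ x. ?lg x \<partial>lborel) + (\<integral>\<^sup>+ x. ?ug x \<partial>lborel)"
      using mass by (subst (1 2) nn_integral_add[symmetric]) (simp_all add: splitf splitg)
    then have cm': "(\<integral>\<^sup>+ x. ?uf x \<partial>lborel) = (\<integral>\<^sup>+ x. ?ug x \<partial>lborel)"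
      using fin by (auto simp: cm)
    have lsum: "(\<Sum>j\<in>Basis. (bl - a) \<bullet> j + (bl' - a') \<bullet> j)
        = (\<Sum>j\<in>Basis. (b - a) \<bullet> j + (b' - a') \<bullet> j) - ((b \<bullet> i - c) + (b' \<bullet> i - c'))"
      unfolding bl_def bl'_def
      by (simp add: inner_simps sum.distrib sum_subtractf sumi algebra_simps)
    have usum: "(\<Sum>j\<in>Basis. (b - au) \<bullet> j + (b' - au') \<bullet> j)
        = (\<Sum>j\<in>Basis. (b - a) \<bullet> j + (b' - a') \<bullet> j) - ((c - a \<bullet> i) + (c' - a' \<bullet> i))"
      unfolding au_def au'_def
      by (simp add: inner_simps sum.distrib sum_subtractf sumi algebra_simps)
    have L: "cell_coupling t \<eta> (box (t *\<^sub>R a + a') (t *\<^sub>R bl + bl')) ?lf ?lg"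
    proof (rule Suc.IH[OF bd(1,3) cm])
      show "(\<Sum>j\<in>Basis. (bl - a) \<bullet> j + (bl' - a') \<bullet> j) \<le> real N * (\<delta> / 2)"
        using lsum short Suc.prems(6) by (simp add: distrib_right)
    qed (use le c in \<open>auto simp: comp\<close>)
    have U: "cell_coupling t \<eta> (box (t *\<^sub>R au + au') (t *\<^sub>R b + b')) ?uf ?ug"
    proof (rule Suc.IH[OF bd(2,4) cm'])
      show "(\<Sum>j\<in>Basis. (b - au) \<bullet> j + (b' - au') \<bullet> j) \<le> real N * (\<delta> / 2)"
        using usum short Suc.prems(6) by (simp add: distrib_right)
    qed (use le c in \<open>auto simp: comp\<close>)
    \<comment> \<open>The hyperplane where the i-th coordinate equals t c + c' separates the two
      Minkowski sums. Open boxes exclude the common face.\<close>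
    have "box (t *\<^sub>R a + a') (t *\<^sub>R bl + bl') \<inter> box (t *\<^sub>R au + au') (t *\<^sub>R b + b') = {}"
    proof (rule ccontr)
      assume "\<not> ?thesis"
      then obtain z where "z \<in> box (t *\<^sub>R a + a') (t *\<^sub>R bl + bl')" "z \<in> box (t *\<^sub>R au + au') (t *\<^sub>R b + b')"
        by blast
      with i have "z \<bullet> i < (t *\<^sub>R bl + bl') \<bullet> i" "(t *\<^sub>R au + au') \<bullet> i < z \<bullet> i"
        by (auto simp: mem_box)
      with i show False by (simp add: inner_add_left comp)
    qed
    moreover have "box (t *\<^sub>R a + a') (t *\<^sub>R bl + bl') \<subseteq> box (t *\<^sub>R a + a') (t *\<^sub>R b + b')"
      using c t by (intro subset_box_imp)
        (auto simp: inner_simps comp intro!: add_mono mult_left_mono)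
    moreover have "box (t *\<^sub>R au + au') (t *\<^sub>R b + b') \<subseteq> box (t *\<^sub>R a + a') (t *\<^sub>R b + b')"
      using c t by (intro subset_box_imp)
        (auto simp: inner_simps comp intro!: add_mono mult_left_mono)
    ultimately have "cell_coupling t \<eta> (box (t *\<^sub>R a + a') (t *\<^sub>R b + b')) (\<lambda>x. ?lf x + ?uf x) (\<lambda>x. ?lg x + ?ug x)"
      by (intro cell_coupling_add[OF L U]) auto
    then show ?thesis by (simp only: splitf splitg)
  qed
qed

lemma cell_coupling_boxes:
  fixes a b a' b' :: "'a::euclidean_space"
  assumes "0 < t" "0 < \<eta>" "box_density a b f" "box_density a' b' g"
    and "(\<integral>\<^sup>+ x. f x \<partial>lborel) = (\<integral>\<^sup>+ x. g x \<partial>lborel)"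
    and "\<And>i. i \<in> Basis \<Longrightarrow> a \<bullet> i \<le> b \<bullet> i" "\<And>i. i \<in> Basis \<Longrightarrow> a' \<bullet> i \<le> b' \<bullet> i"
  shows "cell_coupling t \<eta> (box (t *\<^sub>R a + a') (t *\<^sub>R b + b')) f g"
proof -
  \<comment> \<open>Chosen so that n (1 + t) \<delta> equals \<eta>, the tolerance of the base
    case.\<close>
  define \<delta> where "\<delta> = \<eta> / (DIM('a) * (1 + t))"
  have \<delta>: "0 < \<delta>" "DIM('a) * ((1 + t) * \<delta>) \<le> \<eta>" using assms by (auto simp: \<delta>_def)
  obtain N :: nat where "(\<Sum>i\<in>Basis. (b - a) \<bullet> i + (b' - a') \<bullet> i) / (\<delta> / 2) \<le> N"
    using real_arch_simple by blast
  then have "(\<Sum>i\<in>Basis. (b - a) \<bullet> i + (b' - a') \<bullet> i) \<le> N * (\<delta> / 2)"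
    using \<delta> by (simp add: divide_le_eq)
  with cell_coupling_boxes_aux[OF assms(1) \<delta> assms(3-7)] show ?thesis by blast
qed

subsection \<open>Bounded sets and balls\<close>

lemma box_density_indicator:
  fixes D :: "'a::euclidean_space set"
  assumes "D \<in> sets borel" "\<And>x. x \<in> D \<Longrightarrow> norm x \<le> L"
  shows "box_density (- (L *\<^sub>R One)) (L *\<^sub>R One) (indicator D)"
proof -
  have "x \<in> cbox (- (L *\<^sub>R One)) (L *\<^sub>R One)" if "x \<in> D" for x :: 'a
  proof -
    have "\<bar>x \<bullet> i\<bar> \<le> L" if "i \<in> Basis" for i
      using Basis_le_norm[OF that, of x] assms(2)[OF \<open>x \<in> D\<close>] by linarith
    then show ?thesis by (auto simp: mem_box abs_le_iff) (metis minus_le_iff)+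
  qed
  then show ?thesis using assms(1) by (auto simp: box_density_def indicator_def)
qed

text \<open>With S and m the moments of \<open>D\<close> and the ball, the bathtub bound and the
  polarisation identity combine to t (C + m + t m) \<le> t (S + t S) plus an error from the cell
  size. Division by t leaves t S as second-order loss and the cell error over t; each is kept below
  \<epsilon> / 2.\<close>

lemma bounded_set_coupling:
  fixes D :: "'a::euclidean_space set"
  assumes [measurable]: "D \<in> sets borel" and "bounded D" and r: "0 \<le> r"
    and vol: "emeasure lborel (ball (0::'a) r) = emeasure lborel D" and \<epsilon>: "0 < \<epsilon>"
  obtains k where "coupling_density (indicator D) (indicator (ball 0 r)) k"
    "(\<integral>\<^sup>+ z. ennreal ((dist (fst z) (snd z))\<^sup>2) * k z \<partial>(lborel \<Otimes>\<^sub>M lborel))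
       + (\<integral>\<^sup>+ x. ennreal ((norm x)\<^sup>2) * indicator (ball (0::'a) r) x \<partial>lborel)
     \<le> (\<integral>\<^sup>+ x. ennreal ((norm x)\<^sup>2) * indicator D x \<partial>lborel) + ennreal \<epsilon>"
proof -
  obtain L where L: "\<And>x. x \<in> D \<union> ball 0 r \<Longrightarrow> norm x \<le> L" "0 < L"
  proof -
    have "bounded (D \<union> ball 0 r)" using \<open>bounded D\<close> by simp
    then show ?thesis using that unfolding bounded_pos by blast
  qed
  let ?w = "L *\<^sub>R One :: 'a"
  have bD: "box_density (- ?w) ?w (indicator D)" and bB: "box_density (- ?w) ?w (indicator (ball 0 r))"
    by (rule box_density_indicator; use L in auto)+
  have fin: "(\<integral>\<^sup>+ x. ennreal ((norm x)\<^sup>2) * indicator A x \<partial>lborel) < \<infinity>"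
    if [measurable]: "A \<in> sets borel" and A: "\<And>x. x \<in> A \<Longrightarrow> norm x \<le> L" and v: "emeasure lborel A < \<infinity>" for A :: "'a set"
  proof -
    have "(\<integral>\<^sup>+ x. ennreal ((norm x)\<^sup>2) * indicator A x \<partial>lborel) \<le> (\<integral>\<^sup>+ x. ennreal (L\<^sup>2) * indicator A x \<partial>lborel)"
      using A by (intro nn_integral_mono) (auto simp: indicator_def intro!: ennreal_leI power_mono)
    also have "\<dots> < \<infinity>" using v by (simp add: nn_integral_cmult ennreal_mult_less_top)
    finally show ?thesis .
  qed
  have vB: "emeasure lborel (ball (0::'a) r) < \<infinity>" by (rule emeasure_lborel_ball_finite)
  obtain V where V: "emeasure lborel (ball (0::'a) r) = ennreal V" "0 \<le> V"
    using vB by (cases "emeasure lborel (ball (0::'a) r)") auto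
  have "(\<integral>\<^sup>+ x. ennreal ((norm x)\<^sup>2) * indicator D x \<partial>lborel) < \<infinity>"
    using fin[of D] L(1) vB vol by auto
  then obtain S where S: "(\<integral>\<^sup>+ x. ennreal ((norm x)\<^sup>2) * indicator D x \<partial>lborel) = ennreal S" "0 \<le> S"
    by (cases "\<integral>\<^sup>+ x. ennreal ((norm x)\<^sup>2) * indicator D x \<partial>lborel") auto
  have "(\<integral>\<^sup>+ x. ennreal ((norm x)\<^sup>2) * indicator (ball (0::'a) r) x \<partial>lborel) < \<infinity>"
    using fin[of "ball 0 r"] L(1) vB by auto
  then obtain m where m: "(\<integral>\<^sup>+ x. ennreal ((norm x)\<^sup>2) * indicator (ball (0::'a) r) x \<partial>lborel) = ennreal m" "0 \<le> m"
    by (cases "\<integral>\<^sup>+ x. ennreal ((norm x)\<^sup>2) * indicator (ball (0::'a) r) x \<partial>lborel") auto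
  \<comment> \<open>Makes t S at most \<epsilon> / 2. The bound t \<le> 1 lets X be estimated
    independently of t, and S + 1 avoids division by zero.\<close>
  define t where "t = min 1 (\<epsilon> / (2 * (S + 1)))"
  have t: "0 < t" "t \<le> 1" "t * S \<le> \<epsilon> / 2"
  proof -
    show "0 < t" "t \<le> 1" using \<epsilon> S(2) by (auto simp: t_def)
    have "t * S \<le> \<epsilon> / (2 * (S + 1)) * (S + 1)" using \<epsilon> S(2) by (intro mult_mono) (auto simp: t_def)
    also have "\<dots> = \<epsilon> / 2" using S(2) by (simp add: field_simps)
    finally show "t * S \<le> \<epsilon> / 2" .
  qed
  \<comment> \<open>The cell error is \<eta> X + (\<eta> + \<eta>^2) V. Since t \<le> 1 gives X
    \<le> 2 S + 2 m and \<eta> \<le> 1 gives \<eta> + \<eta>^2 \<le> 2 \<eta>, it is at most \<eta>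
    H; the summand 1 keeps H positive.\<close>
  define H where "H = 2 * S + 2 * m + 2 * V + 1"
  have H: "0 < H" using S m V by (simp add: H_def)
  define \<eta> where "\<eta> = min 1 (t * \<epsilon> / (2 * H))"
  have \<eta>: "0 < \<eta>" "\<eta> \<le> 1" "\<eta> * H \<le> t * (\<epsilon> / 2)"
  proof -
    show "0 < \<eta>" "\<eta> \<le> 1" using \<epsilon> H t by (auto simp: \<eta>_def)
    have "\<eta> * H \<le> t * \<epsilon> / (2 * H) * H" using H by (intro mult_right_mono) (auto simp: \<eta>_def)
    also have "\<dots> = t * (\<epsilon> / 2)" using H by (simp add: field_simps)
    finally show "\<eta> * H \<le> t * (\<epsilon> / 2)" .
  qed
  have "cell_coupling t \<eta> (box (t *\<^sub>R (- ?w) + (- ?w)) (t *\<^sub>R ?w + ?w)) (indicator D) (indicator (ball 0 r))"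
    using L(2) by (intro cell_coupling_boxes[OF t(1) \<eta>(1) bD bB]) (auto simp: vol)
  then obtain k and \<theta> :: "'a \<Rightarrow> ennreal" where k: "coupling_density (indicator D) (indicator (ball 0 r)) k"
    and th: "\<theta> \<in> borel_measurable borel" "\<And>z. \<theta> z \<le> 1"
    "(\<integral>\<^sup>+ z. \<theta> z \<partial>lborel) = ennreal ((1 + t) ^ DIM('a)) * (\<integral>\<^sup>+ x. indicator D x \<partial>lborel)"
    "(\<integral>\<^sup>+ z. ennreal ((norm z)\<^sup>2) * \<theta> z \<partial>lborel) \<le> ennreal ((1 + t) ^ DIM('a)) *
       (\<integral>\<^sup>+ z. ennreal ((norm (t *\<^sub>R fst z + snd z) + \<eta>)\<^sup>2) * k z \<partial>(lborel \<Otimes>\<^sub>M lborel))"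
    unfolding cell_coupling_def by blast
  note [measurable] = coupling_density_measurable[OF k]
  let ?X = "\<integral>\<^sup>+ z. ennreal ((norm (t *\<^sub>R fst z + snd z))\<^sup>2) * k z \<partial>(lborel \<Otimes>\<^sub>M lborel)"
  let ?C = "\<integral>\<^sup>+ z. ennreal ((dist (fst z) (snd z))\<^sup>2) * k z \<partial>(lborel \<Otimes>\<^sub>M lborel)"
  \<comment> \<open>The identity is integrated against the coupling; its right-hand side splits into
    functions of x and of y alone, so only the marginals matter there.\<close>
  have "?X + ennreal t * ?C = (\<integral>\<^sup>+ z. ennreal (t * (1 + t)) * (ennreal ((norm (fst z))\<^sup>2) * k z)
      + ennreal (1 + t) * (ennreal ((norm (snd z))\<^sup>2) * k z) \<partial>(lborel \<Otimes>\<^sub>M lborel))"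
  proof -
    have "(norm (t *\<^sub>R x + y))\<^sup>2 + t * (dist x y)\<^sup>2 = t * (1 + t) * (norm x)\<^sup>2 + (1 + t) * (norm y)\<^sup>2" for x y :: 'a
      by (simp add: dist_norm power2_norm_eq_inner inner_simps algebra_simps inner_commute)
    then have "ennreal ((norm (t *\<^sub>R x + y))\<^sup>2) + ennreal t * ennreal ((dist x y)\<^sup>2)
      = ennreal (t * (1 + t)) * ennreal ((norm x)\<^sup>2) + ennreal (1 + t) * ennreal ((norm y)\<^sup>2)" for x y :: 'a
      using t(1) by (simp flip: ennreal_mult ennreal_plus)
    then have "ennreal ((norm (t *\<^sub>R x + y))\<^sup>2) * c + ennreal t * (ennreal ((dist x y)\<^sup>2) * c)
      = ennreal (t * (1 + t)) * (ennreal ((norm x)\<^sup>2) * c) + ennreal (1 + t) * (ennreal ((norm y)\<^sup>2) * c)"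
      for x y :: 'a and c
      by (metis distrib_right mult.assoc)
    then show ?thesis
      by (subst nn_integral_cmult[symmetric], simp) (subst nn_integral_add[symmetric], auto)
  qed
  also have "\<dots> = ennreal (t * (1 + t)) * ennreal S + ennreal (1 + t) * ennreal m"
    using nn_integral_coupling_fst[OF k, of "\<lambda>x. ennreal ((norm x)\<^sup>2)"]
      nn_integral_coupling_snd[OF k, of "\<lambda>x. ennreal ((norm x)\<^sup>2)"]
    by (simp add: nn_integral_add nn_integral_cmult S m)
  also have "\<dots> = ennreal (t * (1 + t) * S + (1 + t) * m)"
    using t S m by (simp add: ennreal_mult ennreal_plus)
  finally have XC: "?X + ennreal t * ?C = ennreal (t * (1 + t) * S + (1 + t) * m)" .
  then have "?X + ennreal t * ?C < \<infinity>" by simp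
  then have "?X < \<infinity>" "ennreal t * ?C < \<infinity>" by auto
  with t(1) have "?X < \<infinity>" "?C < \<infinity>" by (auto simp: ennreal_mult_less_top)
  then obtain X C where X: "?X = ennreal X" "0 \<le> X" and C: "?C = ennreal C" "0 \<le> C"
    by (cases ?X; cases ?C) auto
  have eq: "X + t * C = t * (1 + t) * S + (1 + t) * m"
    using XC t S m X C by (simp flip: ennreal_mult ennreal_plus)
  \<comment> \<open>\<open>\<theta>\<close> has the mass of the ball of radius (1 + t) r, so the
    bathtub principle compares it with that ball; the factor (1 + t)^n then cancels.\<close>
  have "ennreal ((1 + t) ^ DIM('a)) * (ennreal ((1 + t)\<^sup>2) * ennreal m)
    = (\<integral>\<^sup>+ z. ennreal ((norm z)\<^sup>2) * indicator (ball (0::'a) ((1 + t) * r)) z \<partial>lborel)"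
    using r t by (simp add: second_moment_ball_dilate m mult.assoc)
  also have "\<dots> \<le> (\<integral>\<^sup>+ z. ennreal ((norm z)\<^sup>2) * \<theta> z \<partial>lborel)"
    using r t th vol by (intro bathtub_ball) (auto simp: emeasure_ball_dilate)
  also note th(4)
  finally have "ennreal ((1 + t)\<^sup>2) * ennreal m
      \<le> (\<integral>\<^sup>+ z. ennreal ((norm (t *\<^sub>R fst z + snd z) + \<eta>)\<^sup>2) * k z \<partial>(lborel \<Otimes>\<^sub>M lborel))"
    using t by (subst (asm) ennreal_mult_le_mult_iff) auto
  also have "\<dots> \<le> (\<integral>\<^sup>+ z. ennreal (1 + \<eta>) * (ennreal ((norm (t *\<^sub>R fst z + snd z))\<^sup>2) * k z)
      + ennreal (\<eta> + \<eta>\<^sup>2) * k z \<partial>(lborel \<Otimes>\<^sub>M lborel))"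
  proof (rule nn_integral_mono)
    fix z :: "'a \<times> 'a"
    let ?u = "norm (t *\<^sub>R fst z + snd z)"
    \<comment> \<open>Equivalent to 2 u \<eta> \<le> \<eta> u^2 + \<eta>, which trades the shift by
      \<eta> for multiples of X and of the total mass V.\<close>
    have "0 \<le> \<eta> * (?u - 1)\<^sup>2" using \<eta> by simp
    then have "(?u + \<eta>)\<^sup>2 \<le> (1 + \<eta>) * ?u\<^sup>2 + (\<eta> + \<eta>\<^sup>2)"
      by (simp add: power2_eq_square algebra_simps)
    then have "ennreal ((?u + \<eta>)\<^sup>2) \<le> ennreal (1 + \<eta>) * ennreal (?u\<^sup>2) + ennreal (\<eta> + \<eta>\<^sup>2)"
      using \<eta> by (simp flip: ennreal_mult ennreal_plus)
    then show "ennreal ((?u + \<eta>)\<^sup>2) * k z \<le> ennreal (1 + \<eta>) * (ennreal (?u\<^sup>2) * k z) + ennreal (\<eta> + \<eta>\<^sup>2) * k z"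
      by (metis distrib_right mult.assoc mult_right_mono zero_le)
  qed
  also have "\<dots> = ennreal (1 + \<eta>) * ennreal X + ennreal (\<eta> + \<eta>\<^sup>2) * ennreal V"
    by (simp add: nn_integral_add nn_integral_cmult X coupling_density_mass[OF k] V flip: vol)
  finally have "(1 + t)\<^sup>2 * m \<le> (1 + \<eta>) * X + (\<eta> + \<eta>\<^sup>2) * V"
    using t \<eta> m X V by (simp flip: ennreal_mult ennreal_plus)
  then have "(1 + t)\<^sup>2 * m + t * C \<le> t * (1 + t) * S + (1 + t) * m + (\<eta> * X + (\<eta> + \<eta>\<^sup>2) * V)"
    using eq by (simp add: algebra_simps)
  moreover have "\<eta> * X + (\<eta> + \<eta>\<^sup>2) * V \<le> t * (\<epsilon> / 2)"
  proof -
    have "t * (1 + t) \<le> 1 * 2" using t by (intro mult_mono) auto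
    then have "t * (1 + t) * S \<le> 2 * S" "(1 + t) * m \<le> 2 * m"
      using t S m by (auto intro!: mult_right_mono)
    moreover have "0 \<le> t * C" using t C by simp
    ultimately have "X \<le> 2 * S + 2 * m" using eq by linarith
    then have "\<eta> * X \<le> \<eta> * (2 * S + 2 * m)" using \<eta> by (intro mult_left_mono) auto
    moreover have "\<eta>\<^sup>2 \<le> \<eta>" using \<eta> by (simp add: power2_eq_square mult_le_one)
    then have "(\<eta> + \<eta>\<^sup>2) * V \<le> (2 * \<eta>) * V" using V by (intro mult_right_mono) auto
    ultimately have "\<eta> * X + (\<eta> + \<eta>\<^sup>2) * V \<le> \<eta> * H"
      using \<eta> by (simp add: H_def algebra_simps)
    with \<eta>(3) show ?thesis by simp
  qed
  ultimately have "t * (C + m + t * m) \<le> t * (S + t * S + \<epsilon> / 2)"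
    by (simp add: power2_eq_square algebra_simps)
  then have "C + m + t * m \<le> S + t * S + \<epsilon> / 2" using t(1) by simp
  moreover have "0 \<le> t * m" using t m by simp
  ultimately have "C + m \<le> S + \<epsilon>" using t(3) by linarith
  then have "?C + ennreal m \<le> ennreal S + ennreal \<epsilon>"
    using C S m \<epsilon> by (simp flip: ennreal_plus)
  with k that show ?thesis using S m by simp
qed

subsection \<open>Rearrangements and layers\<close>

text \<open>An explicit form of the radius described in \<open>sym_ball\<close>; measurability in
  the level and monotonicity in the volume can be read off it.\<close>

definition sym_radius :: "'a::euclidean_space set \<Rightarrow> real" where
  "sym_radius D = root DIM('a) (enn2real (emeasure lebesgue D) / unit_ball_vol DIM('a))"

lemma sym_radius_nonneg: "0 \<le> sym_radius D"
  by (simp add: sym_radius_def)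

lemma emeasure_ball_sym_radius:
  fixes D :: "'a::euclidean_space set"
  assumes "emeasure lebesgue D < \<infinity>"
  shows "emeasure lborel (ball (0::'a) (sym_radius D)) = emeasure lebesgue D"
proof -
  have "sym_radius D ^ DIM('a) = enn2real (emeasure lebesgue D) / unit_ball_vol DIM('a)"
    unfolding sym_radius_def by (rule real_root_pow_pos2) auto
  moreover have "0 < unit_ball_vol (real DIM('a))" by simp
  ultimately have "unit_ball_vol DIM('a) * sym_radius D ^ DIM('a) = enn2real (emeasure lebesgue D)"
    by (simp add: field_simps)
  then show ?thesis
    using assms by (simp add: emeasure_ball[OF sym_radius_nonneg])
qed

lemma sym_ball_eq:
  fixes D :: "'a::euclidean_space set"
  assumes "emeasure lebesgue D < \<infinity>"
  shows "sym_ball D = ball 0 (sym_radius D)"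
proof -
  have "(THE r. 0 \<le> r \<and> emeasure lebesgue (ball (0::'a) r) = emeasure lebesgue D) = sym_radius D"
  proof (rule the_equality)
    show "0 \<le> sym_radius D \<and> emeasure lebesgue (ball (0::'a) (sym_radius D)) = emeasure lebesgue D"
      using emeasure_ball_sym_radius[OF assms] by (simp add: sym_radius_nonneg)
    fix r assume r: "0 \<le> r \<and> emeasure lebesgue (ball (0::'a) r) = emeasure lebesgue D"
    then have "emeasure lborel (ball (0::'a) r) = emeasure lborel (ball (0::'a) (sym_radius D))"
      using emeasure_ball_sym_radius[OF assms] by simp
    then have "unit_ball_vol DIM('a) * r ^ DIM('a) = unit_ball_vol DIM('a) * sym_radius D ^ DIM('a)"
      using r by (simp add: emeasure_ball sym_radius_nonneg del: mult_cancel_left)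
    moreover have "unit_ball_vol (real DIM('a)) \<noteq> 0"
      using unit_ball_vol_pos[of "real DIM('a)"] by (metis less_irrefl of_nat_0_le_iff)
    ultimately have "r ^ DIM('a) = sym_radius D ^ DIM('a)" by simp
    then show "r = sym_radius D"
      using r sym_radius_nonneg by (auto dest!: power_eq_imp_eq_base)
  qed
  then show ?thesis by (simp add: sym_ball_def)
qed

lemma sym_radius_mono:
  fixes D E :: "'a::euclidean_space set"
  assumes "emeasure lebesgue D \<le> emeasure lebesgue E" "emeasure lebesgue E < \<infinity>"
  shows "sym_radius D \<le> sym_radius E"
  unfolding sym_radius_def using assms
  by (intro real_root_le_mono divide_right_mono enn2real_mono) auto

text \<open>Markov's inequality.\<close>

lemma emeasure_superlevel_finite:
  fixes \<rho> :: "'a::euclidean_space \<Rightarrow> ennreal"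
  assumes [measurable]: "\<rho> \<in> borel_measurable borel" and fin: "(\<integral>\<^sup>+ x. \<rho> x \<partial>lborel) < \<infinity>" and "0 < h"
  shows "emeasure lborel {x. ennreal h < \<rho> x} < \<infinity>"
proof -
  have "ennreal h * emeasure lborel {x. ennreal h < \<rho> x} = (\<integral>\<^sup>+ x. ennreal h * indicator {x. ennreal h < \<rho> x} x \<partial>lborel)"
    by (simp add: nn_integral_cmult)
  also have "\<dots> \<le> (\<integral>\<^sup>+ x. \<rho> x \<partial>lborel)"
    by (intro nn_integral_mono) (auto simp: indicator_def)
  finally have "ennreal h * emeasure lborel {x. ennreal h < \<rho> x} < \<infinity>" using fin by (rule le_less_trans)
  then show ?thesis using \<open>0 < h\<close> by (auto simp: ennreal_mult_less_top)
qed

text \<open>The positive levels below r form an interval of length r. The case of infinite r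
  matters, since densities may take the value infinity.\<close>

lemma nn_integral_levels: "(\<integral>\<^sup>+ h. indicator {0<..} h * indicator {h. ennreal h < r} h \<partial>lborel) = r"
proof -
  have "(\<integral>\<^sup>+ h. indicator {0<..} h * indicator {h. ennreal h < r} h \<partial>lborel) = emeasure lborel {h. 0 < h \<and> ennreal h < r}"
  proof -
    have "(\<lambda>h. indicator {0<..} h * indicator {h. ennreal h < r} h) = (indicator {h. 0 < h \<and> ennreal h < r} :: real \<Rightarrow> ennreal)"
      by (auto simp: fun_eq_iff indicator_def)
    then show ?thesis by simp
  qed
  also have "\<dots> = r"
  proof (cases r)
    case (real q)
    then have "{h. 0 < h \<and> ennreal h < r} = {0<..<q}"
      by (auto simp: ennreal_less_iff)
    then show ?thesis using real by simp
  next
    case top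
    have "ennreal (real n) \<le> emeasure lborel {0::real<..}" for n
    proof -
      have "{0<..<real n} \<subseteq> {0<..}" by auto
      from emeasure_mono[OF this, of lborel] show ?thesis by simp
    qed
    then have "emeasure lborel {0::real<..} = top"
      using ennreal_SUP_of_nat_eq_top by (metis SUP_least ennreal_of_nat_eq_real_of_nat top.extremum_uniqueI)
    moreover have "{h. 0 < h \<and> ennreal h < r} = {0<..}" using top by auto
    ultimately show ?thesis using top by simp
  qed
  finally show ?thesis .
qed

text \<open>Tonelli's theorem on points and levels. The weight \<open>\<phi>\<close> is 1 for masses
  and |x|^2 for moments.\<close>

lemma layer_cake:
  fixes \<rho> :: "'a::euclidean_space \<Rightarrow> ennreal"
  assumes [measurable]: "\<rho> \<in> borel_measurable borel" "\<phi> \<in> borel_measurable borel"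
  shows "(\<integral>\<^sup>+ x. \<phi> x * \<rho> x \<partial>lborel)
    = (\<integral>\<^sup>+ h. indicator {0<..} h * (\<integral>\<^sup>+ x. \<phi> x * indicator {x. ennreal h < \<rho> x} x \<partial>lborel) \<partial>lborel)"
proof -
  have "(\<integral>\<^sup>+ x. \<phi> x * \<rho> x \<partial>lborel)
     = (\<integral>\<^sup>+ x. \<integral>\<^sup>+ h. \<phi> x * (indicator {0<..} h * indicator {h. ennreal h < \<rho> x} h) \<partial>lborel \<partial>lborel)"
    by (subst nn_integral_cmult) (simp_all add: nn_integral_levels)
  also have "\<dots> = (\<integral>\<^sup>+ h. \<integral>\<^sup>+ x. \<phi> x * (indicator {0<..} h * indicator {h. ennreal h < \<rho> x} h) \<partial>lborel \<partial>lborel)"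
    by (rule lborel_pair.Fubini') measurable
  also have "\<dots> = (\<integral>\<^sup>+ h. indicator {0<..} h * (\<integral>\<^sup>+ x. \<phi> x * indicator {x. ennreal h < \<rho> x} x \<partial>lborel) \<partial>lborel)"
    by (subst nn_integral_cmult[symmetric]) (auto intro!: nn_integral_cong simp: indicator_def)
  finally show ?thesis .
qed

text \<open>On positive levels the balls are described by a measurable radius function
  \<open>R\<close>, so the indicator is jointly measurable in point and level. Borel measurability
  and the exchange of integrals then follow from Tonelli's theorem.\<close>

lemma
  fixes \<rho> :: "'a::euclidean_space \<Rightarrow> ennreal"
  assumes [measurable]: "\<rho> \<in> borel_measurable borel" and fin: "(\<integral>\<^sup>+ x. \<rho> x \<partial>lborel) < \<infinity>"
  shows borel_measurable_rearrangement: "sym_decr_rearrangement \<rho> \<in> borel_measurable borel"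
    and layer_cake_rearrangement: "\<phi> \<in> borel_measurable borel \<Longrightarrow>
      (\<integral>\<^sup>+ x. \<phi> x * sym_decr_rearrangement \<rho> x \<partial>lborel)
      = (\<integral>\<^sup>+ h. indicator {0<..} h * (\<integral>\<^sup>+ x. \<phi> x * indicator (sym_ball {x. ennreal h < \<rho> x}) x \<partial>lborel) \<partial>lborel)"
proof -
  define R where "R h = sym_radius {x. ennreal h < \<rho> x}" for h
  have "(\<lambda>h. \<integral>\<^sup>+ x. indicator {x. ennreal h < \<rho> x} x \<partial>lborel) \<in> borel_measurable borel"
    by measurable
  then have [measurable]: "R \<in> borel_measurable borel"
    unfolding R_def sym_radius_def by (simp add: borel_measurable_root)
  have sb: "sym_ball {x. ennreal h < \<rho> x} = ball 0 (R h)" if "0 < h" for h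
    using emeasure_superlevel_finite[OF assms that] by (simp add: sym_ball_eq R_def)
  have sdr: "sym_decr_rearrangement \<rho> = (\<lambda>x. \<integral>\<^sup>+ h. indicator {0<..} h * indicator {h. norm x < R h} h \<partial>lborel)"
    unfolding sym_decr_rearrangement_def
    by (intro ext nn_integral_cong) (auto simp: indicator_def sb)
  show "sym_decr_rearrangement \<rho> \<in> borel_measurable borel"
    unfolding sdr by measurable
  assume [measurable]: "\<phi> \<in> borel_measurable borel"
  have "(\<integral>\<^sup>+ x. \<phi> x * sym_decr_rearrangement \<rho> x \<partial>lborel)
     = (\<integral>\<^sup>+ x. \<integral>\<^sup>+ h. \<phi> x * (indicator {0<..} h * indicator {h. norm x < R h} h) \<partial>lborel \<partial>lborel)"
    unfolding sdr by (subst nn_integral_cmult) simp_all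
  also have "\<dots> = (\<integral>\<^sup>+ h. \<integral>\<^sup>+ x. \<phi> x * (indicator {0<..} h * indicator {h. norm x < R h} h) \<partial>lborel \<partial>lborel)"
    by (rule lborel_pair.Fubini') measurable
  also have "\<dots> = (\<integral>\<^sup>+ h. indicator {0<..} h * (\<integral>\<^sup>+ x. \<phi> x * indicator (sym_ball {x. ennreal h < \<rho> x}) x \<partial>lborel) \<partial>lborel)"
    by (intro nn_integral_cong) (auto simp: indicator_def sb intro!: nn_integral_cong)
  finally show "(\<integral>\<^sup>+ x. \<phi> x * sym_decr_rearrangement \<rho> x \<partial>lborel)
      = (\<integral>\<^sup>+ h. indicator {0<..} h * (\<integral>\<^sup>+ x. \<phi> x * indicator (sym_ball {x. ennreal h < \<rho> x}) x \<partial>lborel) \<partial>lborel)" .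
qed

lemma nn_integral_rearrangement:
  fixes \<rho> :: "'a::euclidean_space \<Rightarrow> ennreal"
  assumes [measurable]: "\<rho> \<in> borel_measurable borel" and fin: "(\<integral>\<^sup>+ x. \<rho> x \<partial>lborel) < \<infinity>"
  shows "(\<integral>\<^sup>+ x. sym_decr_rearrangement \<rho> x \<partial>lborel) = (\<integral>\<^sup>+ x. \<rho> x \<partial>lborel)"
proof -
  have "emeasure lborel (sym_ball {x. ennreal h < \<rho> x}) = emeasure lborel {x. ennreal h < \<rho> x}" if "0 < h" for h
    using emeasure_superlevel_finite[OF assms that] emeasure_ball_sym_radius[of "{x. ennreal h < \<rho> x}"]
    by (simp add: sym_ball_eq)
  moreover have "sym_ball {x. ennreal h < \<rho> x} \<in> sets borel" for h
    by (simp add: sym_ball_def)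
  ultimately have "indicator {0<..} h * (\<integral>\<^sup>+ x. 1 * indicator (sym_ball {x. ennreal h < \<rho> x}) x \<partial>lborel)
      = indicator {0<..} h * (\<integral>\<^sup>+ x. 1 * indicator {x. ennreal h < \<rho> x} x \<partial>lborel)" for h
    by (cases "0 < h") simp_all
  then show ?thesis
    using layer_cake[of \<rho> "\<lambda>_. 1"] layer_cake_rearrangement[OF assms, of "\<lambda>_. 1"] by simp
qed

text \<open>The bathtub principle on each superlevel set. It also shows that the rearrangement has
  finite second moment, which the tail estimate and the final subtraction rely on.\<close>

lemma second_moment_rearrangement_le:
  fixes \<rho> :: "'a::euclidean_space \<Rightarrow> ennreal"
  assumes [measurable]: "\<rho> \<in> borel_measurable borel" and fin: "(\<integral>\<^sup>+ x. \<rho> x \<partial>lborel) < \<infinity>"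
  shows "(\<integral>\<^sup>+ x. ennreal ((norm x)\<^sup>2) * sym_decr_rearrangement \<rho> x \<partial>lborel)
    \<le> (\<integral>\<^sup>+ x. ennreal ((norm x)\<^sup>2) * \<rho> x \<partial>lborel)"
proof -
  have "(\<integral>\<^sup>+ x. ennreal ((norm x)\<^sup>2) * indicator (sym_ball {x. ennreal h < \<rho> x}) x \<partial>lborel)
    \<le> (\<integral>\<^sup>+ x. ennreal ((norm x)\<^sup>2) * indicator {x. ennreal h < \<rho> x} x \<partial>lborel)" if "0 < h" for h
  proof -
    have "emeasure lebesgue {x. ennreal h < \<rho> x} < \<infinity>"
      using emeasure_superlevel_finite[OF assms that] by simp
    then have sb: "sym_ball {x. ennreal h < \<rho> x} = ball 0 (sym_radius {x. ennreal h < \<rho> x})"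
      and em: "emeasure lborel (ball (0::'a) (sym_radius {x. ennreal h < \<rho> x})) = emeasure lborel {x. ennreal h < \<rho> x}"
      by (simp_all add: sym_ball_eq emeasure_ball_sym_radius)
    show ?thesis
      unfolding sb by (rule bathtub_ball) (auto simp: sym_radius_nonneg em split: split_indicator)
  qed
  then show ?thesis
    unfolding layer_cake[of \<rho> "\<lambda>x. ennreal ((norm x)\<^sup>2)", simplified]
      layer_cake_rearrangement[OF assms, of "\<lambda>x. ennreal ((norm x)\<^sup>2)", simplified]
    by (intro nn_integral_mono) (auto simp: indicator_def[of "{0<..}"])
qed

section \<open>Truncation in level and in space\<close>

lemma sum_indicator_intervals:
  fixes \<Delta> h :: real
  assumes "0 \<le> \<Delta>"
  shows "(\<Sum>i<N. indicator {c + i * \<Delta><..c + Suc i * \<Delta>} h) = (indicator {c<..c + N * \<Delta>} h :: ennreal)"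
  using assms
proof (induction N)
  case (Suc N)
  have "indicator {c<..c + N * \<Delta>} h + indicator {c + N * \<Delta><..c + Suc N * \<Delta>} h
     = (indicator {c<..c + Suc N * \<Delta>} h :: ennreal)"
  proof -
    have "0 \<le> N * \<Delta>" "N * \<Delta> \<le> Suc N * \<Delta>" using Suc.prems by (auto simp: algebra_simps)
    then show ?thesis by (auto simp: indicator_def)
  qed
  with Suc show ?case by simp
qed simp

text \<open>The same sum is compared with the integral twice: each value at (i + 1) \<Delta> is a
  lower bound on the interval to its left and an upper bound on the one to its right. The first
  keeps finite layer sums below \<rho> and its rearrangement, the second makes them exhaust the
  mass. The level 0, where superlevel sets may have infinite measure, is never sampled.\<close>

lemma
  fixes \<phi> :: "real \<Rightarrow> ennreal" and \<Delta> :: real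
  assumes anti: "\<And>h h'. 0 < h \<Longrightarrow> h \<le> h' \<Longrightarrow> \<phi> h' \<le> \<phi> h" and \<Delta>: "0 < \<Delta>"
  shows riemann_sum_le: "(\<Sum>i<N. ennreal \<Delta> * \<phi> (Suc i * \<Delta>)) \<le> (\<integral>\<^sup>+ h. indicator {0<..} h * \<phi> h \<partial>lborel)"
    and riemann_sum_ge: "(\<integral>\<^sup>+ h. indicator {\<Delta><..\<Delta> + N * \<Delta>} h * \<phi> h \<partial>lborel) \<le> (\<Sum>i<N. ennreal \<Delta> * \<phi> (Suc i * \<Delta>))"
proof -
  have int: "(\<integral>\<^sup>+ h. (\<Sum>i<N. \<phi> (Suc i * \<Delta>) * indicator {c + i * \<Delta><..c + Suc i * \<Delta>} h) \<partial>lborel)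
     = (\<Sum>i<N. ennreal \<Delta> * \<phi> (Suc i * \<Delta>))" for c
    using \<Delta> by (subst nn_integral_sum) (auto simp: nn_integral_cmult algebra_simps intro!: sum.cong)
  have "(\<Sum>i<N. \<phi> (Suc i * \<Delta>) * indicator {0 + i * \<Delta><..0 + Suc i * \<Delta>} h) \<le> indicator {0<..} h * \<phi> h" for h
  proof -
    have "(\<Sum>i<N. \<phi> (Suc i * \<Delta>) * indicator {0 + i * \<Delta><..0 + Suc i * \<Delta>} h)
        \<le> (\<Sum>i<N. \<phi> h * indicator {0 + i * \<Delta><..0 + Suc i * \<Delta>} h)"
    proof (rule sum_mono)
      fix i :: nat
      have "0 \<le> i * \<Delta>" using \<Delta> by simp
      then show "\<phi> (Suc i * \<Delta>) * indicator {0 + i * \<Delta><..0 + Suc i * \<Delta>} h \<le> \<phi> h * indicator {0 + i * \<Delta><..0 + Suc i * \<Delta>} h"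
        by (auto simp: indicator_def simp del: of_nat_Suc intro!: anti)
    qed
    also have "\<dots> = \<phi> h * indicator {0<..0 + N * \<Delta>} h"
      using \<Delta> by (subst sum_distrib_left[symmetric], subst sum_indicator_intervals) auto
    also have "\<dots> \<le> indicator {0<..} h * \<phi> h" by (auto simp: indicator_def)
    finally show ?thesis .
  qed
  then show "(\<Sum>i<N. ennreal \<Delta> * \<phi> (Suc i * \<Delta>)) \<le> (\<integral>\<^sup>+ h. indicator {0<..} h * \<phi> h \<partial>lborel)"
    unfolding int[of 0, symmetric] by (rule nn_integral_mono)
  have "indicator {\<Delta><..\<Delta> + N * \<Delta>} h * \<phi> h \<le> (\<Sum>i<N. \<phi> (Suc i * \<Delta>) * indicator {\<Delta> + i * \<Delta><..\<Delta> + Suc i * \<Delta>} h)" for h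
  proof -
    have "indicator {\<Delta><..\<Delta> + N * \<Delta>} h * \<phi> h = (\<Sum>i<N. \<phi> h * indicator {\<Delta> + i * \<Delta><..\<Delta> + Suc i * \<Delta>} h)"
      using \<Delta> by (subst sum_distrib_left[symmetric], subst sum_indicator_intervals) (auto simp: mult.commute)
    also have "\<dots> \<le> (\<Sum>i<N. \<phi> (Suc i * \<Delta>) * indicator {\<Delta> + i * \<Delta><..\<Delta> + Suc i * \<Delta>} h)"
    proof (rule sum_mono)
      fix i :: nat
      have "0 < Suc i * \<Delta>" "Suc i * \<Delta> = \<Delta> + i * \<Delta>"
        using \<Delta> by (simp_all add: algebra_simps add_pos_nonneg)
      then show "\<phi> h * indicator {\<Delta> + i * \<Delta><..\<Delta> + Suc i * \<Delta>} h \<le> \<phi> (Suc i * \<Delta>) * indicator {\<Delta> + i * \<Delta><..\<Delta> + Suc i * \<Delta>} h"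
        by (auto simp: indicator_def simp del: of_nat_Suc intro!: anti)
    qed
    finally show ?thesis .
  qed
  then show "(\<integral>\<^sup>+ h. indicator {\<Delta><..\<Delta> + N * \<Delta>} h * \<phi> h \<partial>lborel) \<le> (\<Sum>i<N. ennreal \<Delta> * \<phi> (Suc i * \<Delta>))"
    unfolding int[of \<Delta>, symmetric] by (rule nn_integral_mono)
qed

text \<open>Continuity from above of the finite measure with density \<open>\<phi>\<close> along
  complements of balls.\<close>

lemma tail_integral_small:
  fixes \<phi> :: "'a::euclidean_space \<Rightarrow> ennreal"
  assumes [measurable]: "\<phi> \<in> borel_measurable borel" and fin: "(\<integral>\<^sup>+ x. \<phi> x \<partial>lborel) < \<infinity>" and "0 < \<epsilon>"
  obtains n :: nat where "\<And>M. real n \<le> M \<Longrightarrow> (\<integral>\<^sup>+ x. \<phi> x * indicator {x. M \<le> norm x} x \<partial>lborel) < \<epsilon>"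
proof -
  let ?A = "\<lambda>n::nat. {x::'a. real n \<le> norm x}"
  have em: "emeasure (density lborel \<phi>) (?A n) = (\<integral>\<^sup>+ x. \<phi> x * indicator (?A n) x \<partial>lborel)" for n
    by (subst emeasure_density) auto
  have fin': "(\<integral>\<^sup>+ x. \<phi> x * indicator (?A n) x \<partial>lborel) < \<infinity>" for n
  proof -
    have "(\<integral>\<^sup>+ x. \<phi> x * indicator (?A n) x \<partial>lborel) \<le> (\<integral>\<^sup>+ x. \<phi> x \<partial>lborel)"
      by (intro nn_integral_mono) (auto simp: indicator_def)
    with fin show ?thesis by (rule le_less_trans[rotated])
  qed
  have "(\<lambda>n. emeasure (density lborel \<phi>) (?A n)) \<longlonglongrightarrow> emeasure (density lborel \<phi>) (\<Inter>n. ?A n)"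
  proof (rule Lim_emeasure_decseq)
    show "range ?A \<subseteq> sets (density lborel \<phi>)" by auto
    show "decseq ?A" by (auto simp: decseq_def intro: order_trans[rotated])
    show "emeasure (density lborel \<phi>) (?A n) \<noteq> \<infinity>" for n using fin'[of n] by (simp add: em)
  qed
  moreover have "(\<Inter>n. ?A n) = {}"
  proof -
    have "x \<notin> (\<Inter>n. ?A n)" for x
      using reals_Archimedean2[of "norm x"] by (auto simp: not_le)
    then show ?thesis by blast
  qed
  ultimately have "eventually (\<lambda>n. (\<integral>\<^sup>+ x. \<phi> x * indicator (?A n) x \<partial>lborel) < \<epsilon>) sequentially"
    using \<open>0 < \<epsilon>\<close> by (simp add: em order_tendstoD(2))
  then obtain n where n: "(\<integral>\<^sup>+ x. \<phi> x * indicator (?A n) x \<partial>lborel) < \<epsilon>"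
    by (auto simp: eventually_sequentially)
  have "(\<integral>\<^sup>+ x. \<phi> x * indicator {x. M \<le> norm x} x \<partial>lborel) < \<epsilon>" if "real n \<le> M" for M
  proof -
    have "(\<integral>\<^sup>+ x. \<phi> x * indicator {x. M \<le> norm x} x \<partial>lborel) \<le> (\<integral>\<^sup>+ x. \<phi> x * indicator (?A n) x \<partial>lborel)"
      using that by (intro nn_integral_mono) (auto simp: indicator_def)
    with n show ?thesis by (rule le_less_trans[rotated])
  qed
  then show ?thesis by (rule that)
qed

text \<open>Splitting at radius M shows that a part of \<rho> with little mass has a small second
  moment, once M controls the tail of \<rho> itself. This makes the cost of the uncoupled remainder
  negligible.\<close>

lemma second_moment_le_tail:
  fixes r \<rho> :: "'a::euclidean_space \<Rightarrow> ennreal"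
  assumes [measurable]: "r \<in> borel_measurable borel" "\<rho> \<in> borel_measurable borel"
    and le: "\<And>x. r x \<le> \<rho> x"
  shows "(\<integral>\<^sup>+ x. ennreal ((norm x)\<^sup>2) * r x \<partial>lborel)
    \<le> ennreal (M\<^sup>2) * (\<integral>\<^sup>+ x. r x \<partial>lborel)
      + (\<integral>\<^sup>+ x. ennreal ((norm x)\<^sup>2) * \<rho> x * indicator {x. M \<le> norm x} x \<partial>lborel)"
proof -
  have "ennreal ((norm x)\<^sup>2) * r x \<le> ennreal (M\<^sup>2) * r x + ennreal ((norm x)\<^sup>2) * \<rho> x * indicator {x. M \<le> norm x} x" for x :: 'a
  proof (cases "M \<le> norm x")
    case True
    then show ?thesis using mult_left_mono[OF le[of x], of "ennreal ((norm x)\<^sup>2)"]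
      by (simp add: add_increasing)
  next
    case False
    then have "(norm x)\<^sup>2 \<le> M\<^sup>2" by (intro power_mono) auto
    then show ?thesis by (simp add: False mult_right_mono)
  qed
  then have "(\<integral>\<^sup>+ x. ennreal ((norm x)\<^sup>2) * r x \<partial>lborel)
    \<le> (\<integral>\<^sup>+ x. ennreal (M\<^sup>2) * r x + ennreal ((norm x)\<^sup>2) * \<rho> x * indicator {x. M \<le> norm x} x \<partial>lborel)"
    by (rule nn_integral_mono)
  also have "\<dots> = ennreal (M\<^sup>2) * (\<integral>\<^sup>+ x. r x \<partial>lborel)
      + (\<integral>\<^sup>+ x. ennreal ((norm x)\<^sup>2) * \<rho> x * indicator {x. M \<le> norm x} x \<partial>lborel)"
    by (simp add: nn_integral_add nn_integral_cmult)
  finally show ?thesis .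
qed

text \<open>The mass of \<rho> is the measure of the region under its graph, which is the increasing
  union of the truncations \<open>A n\<close> in level and space. One truncation has almost all the
  mass, and a Riemann sum over levels dominates it.\<close>

lemma superlevel_sums_exhaust:
  fixes \<rho> :: "'a::euclidean_space \<Rightarrow> ennreal"
  assumes [measurable]: "\<rho> \<in> borel_measurable borel" and fin: "(\<integral>\<^sup>+ x. \<rho> x \<partial>lborel) < \<infinity>" and "0 < \<eta>"
  obtains \<Delta> L :: real and N :: nat where "0 < \<Delta>"
    "(\<integral>\<^sup>+ x. \<rho> x \<partial>lborel) \<le> (\<integral>\<^sup>+ x. (\<Sum>i<N. ennreal \<Delta> * indicator ({x. ennreal (Suc i * \<Delta>) < \<rho> x} \<inter> ball 0 L) x) \<partial>lborel) + ennreal \<eta>"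
proof -
  define A where "A n = {z :: 'a \<times> real. 1 / Suc n < snd z \<and> snd z \<le> Suc n \<and> ennreal (snd z) < \<rho> (fst z) \<and> norm (fst z) < Suc n}" for n :: nat
  have A_sets [measurable]: "A n \<in> sets (lborel \<Otimes>\<^sub>M lborel)" for n
  proof -
    have "{z \<in> space (lborel \<Otimes>\<^sub>M lborel). 1 / Suc n < snd z \<and> snd z \<le> Suc n \<and> ennreal (snd z) < \<rho> (fst z) \<and> norm (fst z) < Suc n}
      \<in> sets (lborel \<Otimes>\<^sub>M lborel)" by measurable
    then show ?thesis by (simp add: A_def space_pair_measure)
  qed
  have "(\<lambda>n. emeasure (lborel \<Otimes>\<^sub>M lborel) (A n)) \<longlonglongrightarrow> emeasure (lborel \<Otimes>\<^sub>M lborel) (\<Union>n. A n)"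
  proof (rule Lim_emeasure_incseq)
    show "incseq A"
    proof (rule incseq_SucI, rule subsetI)
      fix n z assume "z \<in> A n"
      moreover have "1 / real (Suc (Suc n)) \<le> 1 / real (Suc n)" by (simp add: field_simps)
      ultimately show "z \<in> A (Suc n)" by (auto simp: A_def)
    qed
  qed (use A_sets in auto)
  also have "(\<Union>n. A n) = {z. 0 < snd z \<and> ennreal (snd z) < \<rho> (fst z)}"
  proof (intro equalityI subsetI)
    fix z assume "z \<in> (\<Union>n. A n)"
    then obtain n where n: "z \<in> A n" by blast
    have "0 < 1 / real (Suc n)" by simp
    also have "\<dots> < snd z" using n by (simp add: A_def)
    finally show "z \<in> {z. 0 < snd z \<and> ennreal (snd z) < \<rho> (fst z)}"
      using n by (simp add: A_def)
  next
    fix z assume z: "z \<in> {z :: 'a \<times> real. 0 < snd z \<and> ennreal (snd z) < \<rho> (fst z)}"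
    obtain n :: nat where n: "1 / snd z + snd z + norm (fst z) < n" using reals_Archimedean2 by blast
    have pos: "0 < 1 / snd z" "0 < snd z" using z by simp_all
    have "1 / snd z < Suc n" "snd z \<le> Suc n" "norm (fst z) < Suc n"
      using n pos norm_ge_zero[of "fst z"] unfolding of_nat_Suc by linarith+
    moreover have "1 / Suc n < snd z"
      using \<open>1 / snd z < Suc n\<close> z by (simp add: field_simps)
    ultimately have "z \<in> A n" using z by (auto simp: A_def)
    then show "z \<in> (\<Union>n. A n)" by blast
  qed
  also have "emeasure (lborel \<Otimes>\<^sub>M lborel) {z. 0 < snd z \<and> ennreal (snd z) < \<rho> (fst z)} = (\<integral>\<^sup>+ x. \<rho> x \<partial>lborel)"
  proof -
    have "emeasure (lborel \<Otimes>\<^sub>M lborel) {z :: 'a \<times> real. 0 < snd z \<and> ennreal (snd z) < \<rho> (fst z)}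
        = (\<integral>\<^sup>+ z. indicator {0<..} (snd z) * indicator {h. ennreal h < \<rho> (fst z)} (snd z) \<partial>(lborel \<Otimes>\<^sub>M lborel))"
    proof -
      have "(\<lambda>z. indicator {0<..} (snd z) * indicator {h. ennreal h < \<rho> (fst z)} (snd z))
        = (indicator {z :: 'a \<times> real. 0 < snd z \<and> ennreal (snd z) < \<rho> (fst z)} :: _ \<Rightarrow> ennreal)"
        by (auto simp: fun_eq_iff indicator_def)
      moreover have "{z \<in> space (lborel \<Otimes>\<^sub>M lborel). 0 < snd z \<and> ennreal (snd z) < \<rho> (fst z)} \<in> sets (lborel \<Otimes>\<^sub>M lborel)"
        by measurable
      ultimately show ?thesis by (simp add: space_pair_measure)
    qed
    also have "\<dots> = (\<integral>\<^sup>+ x. \<integral>\<^sup>+ h. indicator {0<..} h * indicator {h. ennreal h < \<rho> x} h \<partial>lborel \<partial>lborel)"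
      by (subst lborel.nn_integral_fst[symmetric]) auto
    finally show ?thesis by (simp add: nn_integral_levels)
  qed
  finally have lim: "(\<lambda>n. emeasure (lborel \<Otimes>\<^sub>M lborel) (A n)) \<longlonglongrightarrow> (\<integral>\<^sup>+ x. \<rho> x \<partial>lborel)" .
  obtain n where n: "(\<integral>\<^sup>+ x. \<rho> x \<partial>lborel) \<le> emeasure (lborel \<Otimes>\<^sub>M lborel) (A n) + ennreal \<eta>"
  proof (cases "(\<integral>\<^sup>+ x. \<rho> x \<partial>lborel) = 0")
    case True then show ?thesis by (intro that[of 0]) simp
  next
    case False
    then have "(\<integral>\<^sup>+ x. \<rho> x \<partial>lborel) - ennreal \<eta> < (\<integral>\<^sup>+ x. \<rho> x \<partial>lborel)"
      using fin \<open>0 < \<eta>\<close> by (intro ennreal_between) (auto simp: zero_less_iff_neq_zero)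
    then obtain n where "(\<integral>\<^sup>+ x. \<rho> x \<partial>lborel) - ennreal \<eta> < emeasure (lborel \<Otimes>\<^sub>M lborel) (A n)"
      using order_tendstoD(1)[OF lim] by (auto simp: eventually_sequentially)
    then show ?thesis
      by (intro that[of n]) (metis add.commute ennreal_minus_le_iff less_imp_le ennreal_neq_top)
  qed
  \<comment> \<open>\<Delta> is both the mesh and the lowest level of \<open>A n\<close>; N is
    chosen so that \<Delta> + N \<Delta> is its highest level n + 1.\<close>
  define \<Delta> where "\<Delta> = 1 / real (Suc n)"
  define N where "N = Suc n * Suc n - 1"
  have \<Delta>: "0 < \<Delta>" by (simp add: \<Delta>_def)
  have "real N = real (Suc n) * real (Suc n) - 1" by (simp add: N_def algebra_simps)
  then have N\<Delta>: "\<Delta> + N * \<Delta> = real (Suc n)" by (simp add: \<Delta>_def field_simps del: of_nat_Suc)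
  have "emeasure (lborel \<Otimes>\<^sub>M lborel) (A n)
      = (\<integral>\<^sup>+ z. indicator {\<Delta><..\<Delta> + N * \<Delta>} (snd z) * indicator ({x. ennreal (snd z) < \<rho> x} \<inter> ball 0 (Suc n)) (fst z) \<partial>(lborel \<Otimes>\<^sub>M lborel))"
  proof -
    have "(\<lambda>z. indicator {\<Delta><..\<Delta> + N * \<Delta>} (snd z) * indicator ({x. ennreal (snd z) < \<rho> x} \<inter> ball 0 (Suc n)) (fst z))
      = (indicator (A n) :: _ \<Rightarrow> ennreal)"
      unfolding N\<Delta> by (auto simp: fun_eq_iff indicator_def A_def \<Delta>_def simp del: of_nat_Suc)
    then show ?thesis by (simp only: nn_integral_indicator[OF A_sets])
  qed
  also have "\<dots> = (\<integral>\<^sup>+ x. \<integral>\<^sup>+ h. indicator {\<Delta><..\<Delta> + N * \<Delta>} h * indicator ({x. ennreal h < \<rho> x} \<inter> ball 0 (Suc n)) x \<partial>lborel \<partial>lborel)"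
    by (subst lborel.nn_integral_fst[symmetric]) auto
  also have "\<dots> \<le> (\<integral>\<^sup>+ x. (\<Sum>i<N. ennreal \<Delta> * indicator ({x. ennreal (Suc i * \<Delta>) < \<rho> x} \<inter> ball 0 (Suc n)) x) \<partial>lborel)"
  proof (intro nn_integral_mono riemann_sum_ge \<Delta>)
    fix x :: 'a and h h' :: real assume "h \<le> h'"
    then have "ennreal h \<le> ennreal h'" by (rule ennreal_leI)
    then show "indicator ({x. ennreal h' < \<rho> x} \<inter> ball 0 (Suc n)) x \<le> (indicator ({x. ennreal h < \<rho> x} \<inter> ball 0 (Suc n)) x :: ennreal)"
      by (auto simp: indicator_def)
  qed
  finally have "emeasure (lborel \<Otimes>\<^sub>M lborel) (A n)
    \<le> (\<integral>\<^sup>+ x. (\<Sum>i<N. ennreal \<Delta> * indicator ({x. ennreal (Suc i * \<Delta>) < \<rho> x} \<inter> ball 0 (Suc n)) x) \<partial>lborel)" .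
  then show ?thesis
    by (intro that[OF \<Delta>] order_trans[OF n] add_right_mono)
qed

section \<open>Gluing the couplings of the layers\<close>

lemma bounded_sets_sum_coupling:
  fixes E :: "nat \<Rightarrow> 'a::euclidean_space set"
  assumes [measurable]: "\<And>i. E i \<in> sets borel" and bE: "\<And>i. bounded (E i)"
    and r: "\<And>i. 0 \<le> r i" "\<And>i. emeasure lborel (ball (0::'a) (r i)) = emeasure lborel (E i)"
    and \<Delta>: "0 < \<Delta>" and \<epsilon>: "0 < \<epsilon>"
  obtains k where
    "coupling_density (\<lambda>x. \<Sum>i<N. ennreal \<Delta> * indicator (E i) x) (\<lambda>x. \<Sum>i<N. ennreal \<Delta> * indicator (ball 0 (r i)) x) k"
    "(\<integral>\<^sup>+ z. ennreal ((dist (fst z) (snd z))\<^sup>2) * k z \<partial>(lborel \<Otimes>\<^sub>M lborel))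
       + (\<integral>\<^sup>+ x. ennreal ((norm x)\<^sup>2) * (\<Sum>i<N. ennreal \<Delta> * indicator (ball (0::'a) (r i)) x) \<partial>lborel)
     \<le> (\<integral>\<^sup>+ x. ennreal ((norm x)\<^sup>2) * (\<Sum>i<N. ennreal \<Delta> * indicator (E i) x) \<partial>lborel) + ennreal \<epsilon>"
proof -
  let ?n = "\<lambda>x::'a. ennreal ((norm x)\<^sup>2)" and ?d = "\<lambda>z::'a\<times>'a. ennreal ((dist (fst z) (snd z))\<^sup>2)"
  define B where "B i = ball (0::'a) (r i)" for i
  have [measurable]: "B i \<in> sets borel" for i by (simp add: B_def)
  \<comment> \<open>The layers have total weight N \<Delta>, so their errors add up to at most
    \<epsilon>; the summand 1 covers N = 0.\<close>
  define \<epsilon>' where "\<epsilon>' = \<epsilon> / (N * \<Delta> + 1)"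
  have pos: "0 < N * \<Delta> + 1" using \<Delta> by (simp add: add_nonneg_pos)
  then have \<epsilon>': "0 < \<epsilon>'" using \<epsilon> by (simp add: \<epsilon>'_def)
  have "N * \<Delta> * \<epsilon>' \<le> (N * \<Delta> + 1) * \<epsilon>'" using \<epsilon>' by (intro mult_right_mono) auto
  also have "\<dots> = \<epsilon>" using pos by (simp add: \<epsilon>'_def)
  finally have N\<epsilon>': "N * \<Delta> * \<epsilon>' \<le> \<epsilon>" .
  have "\<exists>k. coupling_density (indicator (E i)) (indicator (B i)) k \<and>
    (\<integral>\<^sup>+ z. ?d z * k z \<partial>(lborel \<Otimes>\<^sub>M lborel)) + (\<integral>\<^sup>+ x. ?n x * indicator (B i) x \<partial>lborel)
     \<le> (\<integral>\<^sup>+ x. ?n x * indicator (E i) x \<partial>lborel) + ennreal \<epsilon>'" (is "\<exists>k. ?P i k") for i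
  proof (rule bounded_set_coupling[OF assms(1) bE r \<epsilon>'])
    fix k
    assume "coupling_density (indicator (E i)) (indicator (ball 0 (r i))) k"
      "(\<integral>\<^sup>+ z. ?d z * k z \<partial>(lborel \<Otimes>\<^sub>M lborel)) + (\<integral>\<^sup>+ x. ?n x * indicator (ball 0 (r i)) x \<partial>lborel)
       \<le> (\<integral>\<^sup>+ x. ?n x * indicator (E i) x \<partial>lborel) + ennreal \<epsilon>'"
    then show ?thesis unfolding B_def by (intro exI[of _ k] conjI)
  qed
  then have "\<exists>\<kappa>. \<forall>i. ?P i (\<kappa> i)" by (intro choice allI)
  then obtain \<kappa> where all: "\<forall>i. ?P i (\<kappa> i)" by (elim exE)
  note \<kappa> = conjunct1[OF spec[OF all]] and cost = conjunct2[OF spec[OF all]]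
  note [measurable] = coupling_density_measurable[OF \<kappa>]
  have lin: "(\<integral>\<^sup>+ x. \<phi> x * (\<Sum>i<N. ennreal \<Delta> * \<psi> i x) \<partial>Q) = (\<Sum>i<N. ennreal \<Delta> * (\<integral>\<^sup>+ x. \<phi> x * \<psi> i x \<partial>Q))"
    if [measurable]: "\<phi> \<in> borel_measurable Q" "\<And>i. \<psi> i \<in> borel_measurable Q"
    for \<phi> :: "'b \<Rightarrow> ennreal" and \<psi> :: "nat \<Rightarrow> 'b \<Rightarrow> ennreal" and Q
    by (simp add: sum_distrib_left mult.left_commute[of "\<phi> _"] nn_integral_sum nn_integral_cmult)
  show ?thesis
  proof (rule that)
    show "coupling_density (\<lambda>x. \<Sum>i<N. ennreal \<Delta> * indicator (E i) x) (\<lambda>x. \<Sum>i<N. ennreal \<Delta> * indicator (ball 0 (r i)) x)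
        (\<lambda>z. \<Sum>i<N. ennreal \<Delta> * \<kappa> i z)"
      unfolding B_def[symmetric] by (intro coupling_density_sum coupling_density_cmult \<kappa>) simp
    have c1: "(\<integral>\<^sup>+ z. ?d z * (\<Sum>i<N. ennreal \<Delta> * \<kappa> i z) \<partial>(lborel \<Otimes>\<^sub>M lborel))
        = (\<Sum>i<N. ennreal \<Delta> * (\<integral>\<^sup>+ z. ?d z * \<kappa> i z \<partial>(lborel \<Otimes>\<^sub>M lborel)))"
      by (rule lin) measurable
    have c2: "(\<integral>\<^sup>+ x. ?n x * (\<Sum>i<N. ennreal \<Delta> * indicator (B i) x) \<partial>lborel)
        = (\<Sum>i<N. ennreal \<Delta> * (\<integral>\<^sup>+ x. ?n x * indicator (B i) x \<partial>lborel))"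
      by (rule lin) measurable
    have c3: "(\<integral>\<^sup>+ x. ?n x * (\<Sum>i<N. ennreal \<Delta> * indicator (E i) x) \<partial>lborel)
        = (\<Sum>i<N. ennreal \<Delta> * (\<integral>\<^sup>+ x. ?n x * indicator (E i) x \<partial>lborel))"
      by (rule lin) measurable
    have "(\<integral>\<^sup>+ z. ?d z * (\<Sum>i<N. ennreal \<Delta> * \<kappa> i z) \<partial>(lborel \<Otimes>\<^sub>M lborel))
        + (\<integral>\<^sup>+ x. ?n x * (\<Sum>i<N. ennreal \<Delta> * indicator (B i) x) \<partial>lborel)
      = (\<Sum>i<N. ennreal \<Delta> * ((\<integral>\<^sup>+ z. ?d z * \<kappa> i z \<partial>(lborel \<Otimes>\<^sub>M lborel)) + (\<integral>\<^sup>+ x. ?n x * indicator (B i) x \<partial>lborel)))"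
      unfolding c1 c2 by (simp only: sum.distrib distrib_left)
    also have "\<dots> \<le> (\<Sum>i<N. ennreal \<Delta> * ((\<integral>\<^sup>+ x. ?n x * indicator (E i) x \<partial>lborel) + ennreal \<epsilon>'))"
      by (intro sum_mono mult_left_mono cost zero_le)
    also have "\<dots> = (\<integral>\<^sup>+ x. ?n x * (\<Sum>i<N. ennreal \<Delta> * indicator (E i) x) \<partial>lborel) + of_nat N * (ennreal \<Delta> * ennreal \<epsilon>')"
      unfolding c3 by (simp add: sum.distrib distrib_left)
    also have "of_nat N * (ennreal \<Delta> * ennreal \<epsilon>') = ennreal (N * \<Delta> * \<epsilon>')"
      using \<Delta> \<epsilon>' by (simp add: ennreal_mult ennreal_of_nat_eq_real_of_nat mult.assoc)
    also have "(\<integral>\<^sup>+ x. ?n x * (\<Sum>i<N. ennreal \<Delta> * indicator (E i) x) \<partial>lborel) + ennreal (N * \<Delta> * \<epsilon>')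
       \<le> (\<integral>\<^sup>+ x. ?n x * (\<Sum>i<N. ennreal \<Delta> * indicator (E i) x) \<partial>lborel) + ennreal \<epsilon>"
      by (intro add_left_mono ennreal_leI N\<epsilon>')
    finally show "(\<integral>\<^sup>+ z. ?d z * (\<Sum>i<N. ennreal \<Delta> * \<kappa> i z) \<partial>(lborel \<Otimes>\<^sub>M lborel))
        + (\<integral>\<^sup>+ x. ?n x * (\<Sum>i<N. ennreal \<Delta> * indicator (ball 0 (r i)) x) \<partial>lborel)
      \<le> (\<integral>\<^sup>+ x. ?n x * (\<Sum>i<N. ennreal \<Delta> * indicator (E i) x) \<partial>lborel) + ennreal \<epsilon>"
      unfolding B_def .
  qed
qed

text \<open>Finite layer sums \<open>s\<close> below \<rho> and \<open>s'\<close> below its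
  rearrangement are coupled layer by layer. They have the same mass, hence so do the remainders
  \<open>r\<close> and \<open>r'\<close>, which makes the product coupling of the remainders
  available.\<close>

lemma rearrangement_coupling:
  fixes \<rho> :: "'a::euclidean_space \<Rightarrow> ennreal"
  assumes [measurable]: "\<rho> \<in> borel_measurable borel" and fin: "(\<integral>\<^sup>+ x. \<rho> x \<partial>lborel) < \<infinity>"
    and fin2: "(\<integral>\<^sup>+ x. ennreal ((norm x)\<^sup>2) * \<rho> x \<partial>lborel) < \<infinity>" and \<epsilon>: "0 < \<epsilon>"
  obtains k where "coupling_density \<rho> (sym_decr_rearrangement \<rho>) k"
    "(\<integral>\<^sup>+ z. ennreal ((dist (fst z) (snd z))\<^sup>2) * k z \<partial>(lborel \<Otimes>\<^sub>M lborel))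
       + (\<integral>\<^sup>+ x. ennreal ((norm x)\<^sup>2) * sym_decr_rearrangement \<rho> x \<partial>lborel)
     \<le> (\<integral>\<^sup>+ x. ennreal ((norm x)\<^sup>2) * \<rho> x \<partial>lborel) + ennreal \<epsilon>"
proof -
  let ?\<rho>' = "sym_decr_rearrangement \<rho>"
  let ?n = "\<lambda>x::'a. ennreal ((norm x)\<^sup>2)"
  note [measurable] = borel_measurable_rearrangement[OF assms(1,2)]
  have fin2': "(\<integral>\<^sup>+ x. ?n x * ?\<rho>' x \<partial>lborel) < \<infinity>"
    using second_moment_rearrangement_le[OF assms(1,2)] fin2 by (rule le_less_trans)
  \<comment> \<open>Each remainder will have moment at most \<epsilon> / 10, half from the tail and
    half from its small mass. These moments enter five times in all: twice each in the product cost
    and once more for \<open>r'\<close> in the moment of the rearrangement. Together with \<epsilon>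
    / 2 for the layers this makes \<epsilon>.\<close>
  have e20: "0 < ennreal (\<epsilon> / 20)" using \<epsilon> by simp
  obtain n\<^sub>1 where n1: "\<And>M. real n\<^sub>1 \<le> M \<Longrightarrow> (\<integral>\<^sup>+ x. ?n x * \<rho> x * indicator {x. M \<le> norm x} x \<partial>lborel) < ennreal (\<epsilon> / 20)"
    using tail_integral_small[OF _ fin2 e20] by auto
  obtain n\<^sub>2 where n2: "\<And>M. real n\<^sub>2 \<le> M \<Longrightarrow> (\<integral>\<^sup>+ x. ?n x * ?\<rho>' x * indicator {x. M \<le> norm x} x \<partial>lborel) < ennreal (\<epsilon> / 20)"
    using tail_integral_small[OF _ fin2' e20] by auto
  define M where "M = max 1 (max (real n\<^sub>1) (real n\<^sub>2))"
  have M: "0 < M" "real n\<^sub>1 \<le> M" "real n\<^sub>2 \<le> M" by (auto simp: M_def)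
  define \<eta> where "\<eta> = \<epsilon> / (20 * M\<^sup>2)"
  have \<eta>: "0 < \<eta>" "M\<^sup>2 * \<eta> = \<epsilon> / 20" using \<epsilon> M by (auto simp: \<eta>_def)
  obtain \<Delta> L :: real and N :: nat where \<Delta>: "0 < \<Delta>" and exhaust:
    "(\<integral>\<^sup>+ x. \<rho> x \<partial>lborel) \<le> (\<integral>\<^sup>+ x. (\<Sum>i<N. ennreal \<Delta> * indicator ({x. ennreal (Suc i * \<Delta>) < \<rho> x} \<inter> ball 0 L) x) \<partial>lborel) + ennreal \<eta>"
    using superlevel_sums_exhaust[OF assms(1,2) \<eta>(1)] by blast
  \<comment> \<open>Intersecting with a ball provides the bounding box from which the cutting
    starts.\<close>
  define E where "E i = {x. ennreal (Suc i * \<Delta>) < \<rho> x} \<inter> ball 0 L" for i :: nat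
  have E_sets [measurable]: "E i \<in> sets borel" for i by (simp add: E_def)
  have bE: "bounded (E i)" for i unfolding E_def by (intro bounded_Int) simp
  have fE: "emeasure lebesgue (E i) < \<infinity>" for i
  proof -
    have "emeasure lborel (E i) \<le> emeasure lborel (ball (0::'a) L)" by (intro emeasure_mono) (auto simp: E_def)
    also have "\<dots> < \<infinity>" by (rule emeasure_lborel_ball_finite)
    finally show ?thesis by simp
  qed
  define B where "B i = ball (0::'a) (sym_radius (E i))" for i
  have [measurable]: "B i \<in> sets borel" for i by (simp add: B_def)
  have vB: "emeasure lborel (B i) = emeasure lborel (E i)" for i
    unfolding B_def using fE[of i] by (subst emeasure_ball_sym_radius) auto
  define s where "s x = (\<Sum>i<N. ennreal \<Delta> * indicator (E i) x)" for x
  define s' where "s' x = (\<Sum>i<N. ennreal \<Delta> * indicator (B i) x)" for x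
  let ?d = "\<lambda>z::'a\<times>'a. ennreal ((dist (fst z) (snd z))\<^sup>2)"
  have "\<exists>k. coupling_density s s' k \<and>
      (\<integral>\<^sup>+ z. ?d z * k z \<partial>(lborel \<Otimes>\<^sub>M lborel)) + (\<integral>\<^sup>+ x. ?n x * s' x \<partial>lborel)
      \<le> (\<integral>\<^sup>+ x. ?n x * s x \<partial>lborel) + ennreal (\<epsilon> / 2)"
  proof (rule bounded_sets_sum_coupling[where E = E and r = "\<lambda>i. sym_radius (E i)" and \<Delta> = \<Delta> and \<epsilon> = "\<epsilon> / 2" and N = N])
    fix k
    assume "coupling_density (\<lambda>x. \<Sum>i<N. ennreal \<Delta> * indicator (E i) x) (\<lambda>x. \<Sum>i<N. ennreal \<Delta> * indicator (ball 0 (sym_radius (E i))) x) k"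
      "(\<integral>\<^sup>+ z. ?d z * k z \<partial>(lborel \<Otimes>\<^sub>M lborel))
        + (\<integral>\<^sup>+ x. ?n x * (\<Sum>i<N. ennreal \<Delta> * indicator (ball 0 (sym_radius (E i))) x) \<partial>lborel)
      \<le> (\<integral>\<^sup>+ x. ?n x * (\<Sum>i<N. ennreal \<Delta> * indicator (E i) x) \<partial>lborel) + ennreal (\<epsilon> / 2)"
    then show ?thesis unfolding s_def s'_def B_def by (intro exI[of _ k] conjI)
  qed (use E_sets bE sym_radius_nonneg vB[unfolded B_def] \<Delta> \<epsilon> in simp_all)
  then obtain ks where cks: "coupling_density s s' ks"
    and cs: "(\<integral>\<^sup>+ z. ?d z * ks z \<partial>(lborel \<Otimes>\<^sub>M lborel)) + (\<integral>\<^sup>+ x. ?n x * s' x \<partial>lborel)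
      \<le> (\<integral>\<^sup>+ x. ?n x * s x \<partial>lborel) + ennreal (\<epsilon> / 2)"
    by (elim exE conjE)
  note [measurable] = coupling_density_measurable[OF cks]
  have [measurable]: "s \<in> borel_measurable borel" "s' \<in> borel_measurable borel"
    unfolding s_def s'_def by measurable
  have s_le: "s x \<le> \<rho> x" for x
  proof -
    have "s x \<le> (\<Sum>i<N. ennreal \<Delta> * indicator {x. ennreal (Suc i * \<Delta>) < \<rho> x} x)"
      unfolding s_def by (intro sum_mono mult_left_mono) (auto simp: E_def indicator_def)
    also have "\<dots> \<le> (\<integral>\<^sup>+ h. indicator {0<..} h * indicator {x. ennreal h < \<rho> x} x \<partial>lborel)"
    proof (rule riemann_sum_le[OF _ \<Delta>])
      fix h h' :: real assume "h \<le> h'"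
      then have "ennreal h \<le> ennreal h'" by (rule ennreal_leI)
      then show "indicator {x. ennreal h' < \<rho> x} x \<le> (indicator {x. ennreal h < \<rho> x} x :: ennreal)"
        by (auto simp: indicator_def)
    qed
    also have "\<dots> = \<rho> x"
      using nn_integral_levels[of "\<rho> x"] by (simp add: indicator_def)
    finally show ?thesis .
  qed
  \<comment> \<open>Truncation shrinks volume, so the ball \<open>B i\<close> sits inside the ball
    of the full superlevel set; these balls decrease with the level, and the lower Riemann bound
    applies.\<close>
  have s'_le: "s' x \<le> ?\<rho>' x" for x
  proof -
    have lf: "emeasure lebesgue {x. ennreal h < \<rho> x} < \<infinity>" if "0 < h" for h
      using emeasure_superlevel_finite[OF assms(1,2) that] by simp
    have "s' x \<le> (\<Sum>i<N. ennreal \<Delta> * indicator (sym_ball {x. ennreal (Suc i * \<Delta>) < \<rho> x}) x)"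
      unfolding s'_def
    proof (intro sum_mono mult_left_mono)
      fix i
      have pos: "0 < Suc i * \<Delta>" using \<Delta> by simp
      have "emeasure lebesgue (E i) \<le> emeasure lebesgue {x. ennreal (Suc i * \<Delta>) < \<rho> x}"
        by (intro emeasure_mono) (auto simp: E_def)
      then have "sym_radius (E i) \<le> sym_radius {x. ennreal (Suc i * \<Delta>) < \<rho> x}"
        by (rule sym_radius_mono) (rule lf[OF pos])
      then show "indicator (B i) x \<le> (indicator (sym_ball {x. ennreal (Suc i * \<Delta>) < \<rho> x}) x :: ennreal)"
        unfolding B_def sym_ball_eq[OF lf[OF pos]] by (auto simp: indicator_def)
    qed auto
    also have "\<dots> \<le> (\<integral>\<^sup>+ h. indicator {0<..} h * indicator (sym_ball {x. ennreal h < \<rho> x}) x \<partial>lborel)"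
    proof (rule riemann_sum_le[OF _ \<Delta>])
      fix h h' :: real assume h: "0 < h" "h \<le> h'"
      then have "ennreal h \<le> ennreal h'" by (intro ennreal_leI)
      then have "emeasure lebesgue {x. ennreal h' < \<rho> x} \<le> emeasure lebesgue {x. ennreal h < \<rho> x}"
        by (intro emeasure_mono) auto
      then have "sym_radius {x. ennreal h' < \<rho> x} \<le> sym_radius {x. ennreal h < \<rho> x}"
        by (rule sym_radius_mono) (rule lf[OF h(1)])
      moreover have "0 < h'" using h by simp
      ultimately show "indicator (sym_ball {x. ennreal h' < \<rho> x}) x \<le> (indicator (sym_ball {x. ennreal h < \<rho> x}) x :: ennreal)"
        unfolding sym_ball_eq[OF lf[OF h(1)]] sym_ball_eq[OF lf[OF \<open>0 < h'\<close>]] by (auto simp: indicator_def)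
    qed
    also have "\<dots> = ?\<rho>' x"
      unfolding sym_decr_rearrangement_def by (simp add: mult.commute)
    finally show ?thesis .
  qed

  define r where "r x = \<rho> x - s x" for x
  define r' where "r' x = ?\<rho>' x - s' x" for x
  have [measurable]: "r \<in> borel_measurable borel" "r' \<in> borel_measurable borel"
    unfolding r_def r'_def by measurable
  have sr: "(\<lambda>x. s x + r x) = \<rho>" "(\<lambda>x. s' x + r' x) = ?\<rho>'"
    using s_le s'_le by (simp_all add: r_def r'_def fun_eq_iff add_diff_inverse_ennreal)
  have r_le: "r x \<le> \<rho> x" "r' x \<le> ?\<rho>' x" for x by (auto simp: r_def r'_def)
  have ms: "(\<integral>\<^sup>+ x. s' x \<partial>lborel) = (\<integral>\<^sup>+ x. s x \<partial>lborel)"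
    using nn_integral_coupling_snd[OF cks, of "\<lambda>_. 1"] coupling_density_mass[OF cks] by simp
  have m1: "(\<integral>\<^sup>+ x. s x \<partial>lborel) + (\<integral>\<^sup>+ x. r x \<partial>lborel) = (\<integral>\<^sup>+ x. \<rho> x \<partial>lborel)"
    by (subst nn_integral_add[symmetric]) (simp_all add: sr)
  have m2: "(\<integral>\<^sup>+ x. s x \<partial>lborel) + (\<integral>\<^sup>+ x. r' x \<partial>lborel) = (\<integral>\<^sup>+ x. \<rho> x \<partial>lborel)"
    unfolding ms[symmetric] by (subst nn_integral_add[symmetric])
      (simp_all add: sr nn_integral_rearrangement[OF assms(1,2)])
  have sfin: "(\<integral>\<^sup>+ x. s x \<partial>lborel) < \<infinity>" "(\<integral>\<^sup>+ x. r x \<partial>lborel) < \<infinity>"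
    using m1 fin by (auto simp: less_top[symmetric] simp flip: m1)
  \<comment> \<open>Rearrangement preserves mass and so does the layer coupling; the finite mass of
    \<open>s\<close> can be cancelled.\<close>
  have mr: "(\<integral>\<^sup>+ x. r' x \<partial>lborel) = (\<integral>\<^sup>+ x. r x \<partial>lborel)"
    using m1 m2 sfin(1) by (metis ennreal_add_left_cancel infinity_ennreal_def less_irrefl)
  have "(\<integral>\<^sup>+ x. \<rho> x \<partial>lborel) \<le> (\<integral>\<^sup>+ x. s x \<partial>lborel) + ennreal \<eta>"
    using exhaust unfolding s_def E_def .
  then have r\<eta>: "(\<integral>\<^sup>+ x. r x \<partial>lborel) \<le> ennreal \<eta>"
    using sfin(1) unfolding m1[symmetric] by (auto simp: ennreal_add_left_cancel_le)
  have m\<eta>: "ennreal (M\<^sup>2) * ennreal \<eta> = ennreal (\<epsilon> / 20)"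
    by (simp only: ennreal_mult'[OF zero_le_power2, symmetric] \<eta>(2))
  have "(\<integral>\<^sup>+ x. ?n x * r x \<partial>lborel) \<le> ennreal (\<epsilon> / 20) + ennreal (\<epsilon> / 20)"
    using n1[OF M(2)] mult_left_mono[OF r\<eta>, of "ennreal (M\<^sup>2)"]
    by (intro order_trans[OF second_moment_le_tail[where M = M and \<rho> = \<rho>]] add_mono) (auto simp: r_le m\<eta>)
  then have Mr: "(\<integral>\<^sup>+ x. ?n x * r x \<partial>lborel) \<le> ennreal (\<epsilon> / 10)"
    using \<epsilon> by (simp flip: ennreal_plus)
  have "(\<integral>\<^sup>+ x. ?n x * r' x \<partial>lborel) \<le> ennreal (\<epsilon> / 20) + ennreal (\<epsilon> / 20)"
    using n2[OF M(3)] mult_left_mono[OF r\<eta>, of "ennreal (M\<^sup>2)"]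
    by (intro order_trans[OF second_moment_le_tail[where M = M and \<rho> = "?\<rho>'"]] add_mono) (auto simp: r_le m\<eta> mr)
  then have Mr': "(\<integral>\<^sup>+ x. ?n x * r' x \<partial>lborel) \<le> ennreal (\<epsilon> / 10)"
    using \<epsilon> by (simp flip: ennreal_plus)

  define kr where "kr z = r (fst z) * r' (snd z) / (\<integral>\<^sup>+ x. r x \<partial>lborel)" for z
  have ckr: "coupling_density r r' kr"
    unfolding kr_def using mr sfin(2) by (intro coupling_density_product) auto
  note [measurable] = coupling_density_measurable[OF ckr]
  have "?d z \<le> 2 * ?n (fst z) + 2 * ?n (snd z)" for z
  proof -
    have "0 \<le> (norm (fst z + snd z))\<^sup>2" by simp
    then have "(dist (fst z) (snd z))\<^sup>2 \<le> 2 * (norm (fst z))\<^sup>2 + 2 * (norm (snd z))\<^sup>2"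
      by (simp add: dist_norm power2_norm_eq_inner inner_simps inner_commute)
    then have "?d z \<le> ennreal (2 * (norm (fst z))\<^sup>2 + 2 * (norm (snd z))\<^sup>2)" by (rule ennreal_leI)
    then show ?thesis by (simp add: ennreal_mult)
  qed
  then have "(\<integral>\<^sup>+ z. ?d z * kr z \<partial>(lborel \<Otimes>\<^sub>M lborel))
     \<le> (\<integral>\<^sup>+ z. (2 * ?n (fst z) + 2 * ?n (snd z)) * kr z \<partial>(lborel \<Otimes>\<^sub>M lborel))"
    by (intro nn_integral_mono mult_right_mono) auto
  also have "\<dots> = 2 * (\<integral>\<^sup>+ x. ?n x * r x \<partial>lborel) + 2 * (\<integral>\<^sup>+ x. ?n x * r' x \<partial>lborel)"
    using nn_integral_coupling_fst[OF ckr, of ?n] nn_integral_coupling_snd[OF ckr, of ?n]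
    by (simp add: distrib_right nn_integral_add mult.assoc nn_integral_cmult)
  finally have cr: "(\<integral>\<^sup>+ z. ?d z * kr z \<partial>(lborel \<Otimes>\<^sub>M lborel))
     \<le> 2 * (\<integral>\<^sup>+ x. ?n x * r x \<partial>lborel) + 2 * (\<integral>\<^sup>+ x. ?n x * r' x \<partial>lborel)" .
  have ck: "coupling_density \<rho> ?\<rho>' (\<lambda>z. ks z + kr z)"
    using coupling_density_add[OF cks ckr] by (simp add: sr)
  have M\<rho>: "(\<integral>\<^sup>+ x. ?n x * \<rho> x \<partial>lborel) = (\<integral>\<^sup>+ x. ?n x * s x \<partial>lborel) + (\<integral>\<^sup>+ x. ?n x * r x \<partial>lborel)"
    by (subst sr(1)[symmetric]) (simp add: distrib_left nn_integral_add)
  have M\<rho>': "(\<integral>\<^sup>+ x. ?n x * ?\<rho>' x \<partial>lborel) = (\<integral>\<^sup>+ x. ?n x * s' x \<partial>lborel) + (\<integral>\<^sup>+ x. ?n x * r' x \<partial>lborel)"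
    by (subst sr(2)[symmetric]) (simp add: distrib_left nn_integral_add)
  have "(\<integral>\<^sup>+ z. ?d z * (ks z + kr z) \<partial>(lborel \<Otimes>\<^sub>M lborel)) + (\<integral>\<^sup>+ x. ?n x * ?\<rho>' x \<partial>lborel)
     = ((\<integral>\<^sup>+ z. ?d z * ks z \<partial>(lborel \<Otimes>\<^sub>M lborel)) + (\<integral>\<^sup>+ x. ?n x * s' x \<partial>lborel))
      + ((\<integral>\<^sup>+ z. ?d z * kr z \<partial>(lborel \<Otimes>\<^sub>M lborel)) + (\<integral>\<^sup>+ x. ?n x * r' x \<partial>lborel))"
    unfolding M\<rho>' by (simp add: distrib_left nn_integral_add add_ac)
  also have "\<dots> \<le> ((\<integral>\<^sup>+ x. ?n x * s x \<partial>lborel) + ennreal (\<epsilon> / 2))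
      + ((2 * ennreal (\<epsilon> / 10) + 2 * ennreal (\<epsilon> / 10)) + ennreal (\<epsilon> / 10))"
    by (rule add_mono[OF cs add_mono[OF order_trans[OF cr add_mono[OF mult_left_mono[OF Mr] mult_left_mono[OF Mr']]] Mr']])
      auto
  also have "\<dots> = (\<integral>\<^sup>+ x. ?n x * s x \<partial>lborel) + ennreal \<epsilon>"
  proof -
    have "ennreal (\<epsilon> / 2) + ((2 * ennreal (\<epsilon> / 10) + 2 * ennreal (\<epsilon> / 10)) + ennreal (\<epsilon> / 10)) = ennreal \<epsilon>"
      using \<epsilon> by (simp flip: ennreal_plus ennreal_numeral ennreal_mult)
    then show ?thesis by (simp add: add.assoc)
  qed
  \<comment> \<open>The moment of \<open>r\<close> is simply given away.\<close>
  also have "\<dots> \<le> (\<integral>\<^sup>+ x. ?n x * \<rho> x \<partial>lborel) + ennreal \<epsilon>"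
    unfolding M\<rho> by (intro add_right_mono) simp
  finally show ?thesis using ck by (rule that[rotated])
qed

section \<open>Wasserstein distance and Borel representatives\<close>

lemma distr_coupling_density:
  fixes k :: "'a::euclidean_space \<times> 'a \<Rightarrow> ennreal"
  assumes "coupling_density f g k" and [measurable]: "f \<in> borel_measurable borel" "g \<in> borel_measurable borel"
  shows "distr (density (lborel \<Otimes>\<^sub>M lborel) k) borel fst = density lborel f"
    and "distr (density (lborel \<Otimes>\<^sub>M lborel) k) borel snd = density lborel g"
proof -
  note [measurable] = coupling_density_measurable[OF assms(1)]
  show "distr (density (lborel \<Otimes>\<^sub>M lborel) k) borel fst = density lborel f"
  proof (rule measure_eqI)
    fix A assume "A \<in> sets (distr (density (lborel \<Otimes>\<^sub>M lborel) k) borel fst)"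
    then have [measurable]: "A \<in> sets borel" by simp
    have "emeasure (distr (density (lborel \<Otimes>\<^sub>M lborel) k) borel fst) A
      = (\<integral>\<^sup>+ z. indicator A (fst z) * k z \<partial>(lborel \<Otimes>\<^sub>M lborel))"
    proof -
      have "emeasure (distr (density (lborel \<Otimes>\<^sub>M lborel) k) borel fst) A
        = (\<integral>\<^sup>+ z. indicator A z \<partial>(distr (density (lborel \<Otimes>\<^sub>M lborel) k) borel fst))" by simp
      also have "\<dots> = (\<integral>\<^sup>+ z. k z * indicator A (fst z) \<partial>(lborel \<Otimes>\<^sub>M lborel))"
        by (subst nn_integral_distr; (subst nn_integral_density)?) auto
      finally show ?thesis by (simp add: mult.commute)
    qed
    also have "\<dots> = (\<integral>\<^sup>+ x. indicator A x * f x \<partial>lborel)" by (rule nn_integral_coupling_fst[OF assms(1)]) simp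
    finally show "emeasure (distr (density (lborel \<Otimes>\<^sub>M lborel) k) borel fst) A = emeasure (density lborel f) A"
      by (simp add: emeasure_density mult.commute)
  qed simp
  show "distr (density (lborel \<Otimes>\<^sub>M lborel) k) borel snd = density lborel g"
  proof (rule measure_eqI)
    fix A assume "A \<in> sets (distr (density (lborel \<Otimes>\<^sub>M lborel) k) borel snd)"
    then have [measurable]: "A \<in> sets borel" by simp
    have "emeasure (distr (density (lborel \<Otimes>\<^sub>M lborel) k) borel snd) A
      = (\<integral>\<^sup>+ z. indicator A (snd z) * k z \<partial>(lborel \<Otimes>\<^sub>M lborel))"
    proof -
      have "emeasure (distr (density (lborel \<Otimes>\<^sub>M lborel) k) borel snd) A
        = (\<integral>\<^sup>+ z. indicator A z \<partial>(distr (density (lborel \<Otimes>\<^sub>M lborel) k) borel snd))" by simp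
      also have "\<dots> = (\<integral>\<^sup>+ z. k z * indicator A (snd z) \<partial>(lborel \<Otimes>\<^sub>M lborel))"
        by (subst nn_integral_distr; (subst nn_integral_density)?) auto
      finally show ?thesis by (simp add: mult.commute)
    qed
    also have "\<dots> = (\<integral>\<^sup>+ x. indicator A x * g x \<partial>lborel)" by (rule nn_integral_coupling_snd[OF assms(1)]) simp
    finally show "emeasure (distr (density (lborel \<Otimes>\<^sub>M lborel) k) borel snd) A = emeasure (density lborel g) A"
      by (simp add: emeasure_density mult.commute)
  qed simp
qed

lemma ennreal_sqrt_power2: "(ennreal_sqrt c)\<^sup>2 = c"
  by (cases c) (auto simp: ennreal_sqrt_def ennreal_power power2_eq_square[of top] ennreal_top_mult)

lemma wasserstein2_coupling_density:
  fixes k :: "'a::euclidean_space \<times> 'a \<Rightarrow> ennreal"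
  assumes k: "coupling_density f g k" and [measurable]: "f \<in> borel_measurable borel" "g \<in> borel_measurable borel"
    and mass: "(\<integral>\<^sup>+ x. f x \<partial>lborel) = 1"
  shows "(wasserstein2 (density lborel f) (density lborel g))\<^sup>2
    \<le> (\<integral>\<^sup>+ z. ennreal ((dist (fst z) (snd z))\<^sup>2) * k z \<partial>(lborel \<Otimes>\<^sub>M lborel))"
proof -
  note [measurable] = coupling_density_measurable[OF k]
  let ?\<pi> = "density (lborel \<Otimes>\<^sub>M lborel) k"
  have "prob_space ?\<pi>"
  proof (rule prob_spaceI)
    have "emeasure ?\<pi> (space ?\<pi>) = (\<integral>\<^sup>+ z. indicator (space ?\<pi>) z \<partial>?\<pi>)" by (rule nn_integral_indicator[symmetric]) (rule sets.top)
    also have "\<dots> = (\<integral>\<^sup>+ z. 1 \<partial>?\<pi>)" by (intro nn_integral_cong) simp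
    also have "\<dots> = (\<integral>\<^sup>+ z. k z * 1 \<partial>(lborel \<Otimes>\<^sub>M lborel))"
      by (rule nn_integral_density) auto
    finally show "emeasure ?\<pi> (space ?\<pi>) = 1" by (simp add: coupling_density_mass[OF k] mass)
  qed
  moreover have "sets ?\<pi> = sets (borel \<Otimes>\<^sub>M borel)"
    by (simp cong: sets_pair_measure_cong)
  ultimately have "?\<pi> \<in> couplings (density lborel f) (density lborel g)"
    using distr_coupling_density[OF assms(1-3)] by (simp add: couplings_def)
  then have "(wasserstein2 (density lborel f) (density lborel g))\<^sup>2
    \<le> (\<integral>\<^sup>+ z. ennreal ((dist (fst z) (snd z))\<^sup>2) \<partial>?\<pi>)"
    unfolding wasserstein2_def ennreal_sqrt_power2 by (rule INF_lower)
  also have "\<dots> = (\<integral>\<^sup>+ z. ennreal ((dist (fst z) (snd z))\<^sup>2) * k z \<partial>(lborel \<Otimes>\<^sub>M lborel))"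
    by (subst nn_integral_density) (auto simp: mult.commute)
  finally show ?thesis .
qed

text \<open>On Borel sets, the Lebesgue integral of a Borel function is unchanged by
  completion.\<close>

lemma density_measure_borel:
  assumes [measurable]: "f \<in> borel_measurable borel"
  shows "density_measure f = density lborel f"
proof (rule measure_eqI)
  fix A assume "A \<in> sets (density_measure f)"
  then have [measurable]: "A \<in> sets borel" by (simp add: density_measure_def)
  have [measurable]: "f \<in> borel_measurable lebesgue" by (simp add: measurable_completion)
  have "emeasure (density_measure f) A = emeasure (density lebesgue f) A"
    unfolding density_measure_def by (subst emeasure_distr) (auto intro: measurable_completion)
  also have "\<dots> = emeasure (density lborel f) A"
    by (subst (1 2) emeasure_density) (auto simp: nn_integral_completion)
  finally show "emeasure (density_measure f) A = emeasure (density lborel f) A" .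
qed (simp add: density_measure_def)

text \<open>The rearrangement sees only the measures of superlevel sets, so almost equal functions
  have rearrangements that agree at every point.\<close>

lemma rearrangement_cong_AE:
  assumes "AE x in lebesgue. f x = g x" and [measurable]: "f \<in> borel_measurable lebesgue" "g \<in> borel_measurable lebesgue"
  shows "sym_decr_rearrangement f = sym_decr_rearrangement g"
proof -
  have "emeasure lebesgue {y. f y > ennreal h} = emeasure lebesgue {y. g y > ennreal h}" for h
  proof (rule emeasure_eq_AE)
    show "AE x in lebesgue. (x \<in> {y. f y > ennreal h}) = (x \<in> {y. g y > ennreal h})"
      using assms(1) by eventually_elim simp
    have "{y \<in> space lebesgue. f y > ennreal h} \<in> sets lebesgue" by measurable
    then show "{y. f y > ennreal h} \<in> sets lebesgue" by simp
    have "{y \<in> space lebesgue. g y > ennreal h} \<in> sets lebesgue" by measurable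
    then show "{y. g y > ennreal h} \<in> sets lebesgue" by simp
  qed
  then have "sym_ball {y. f y > ennreal h} = sym_ball {y. g y > ennreal h}" for h
    by (simp add: sym_ball_def)
  then show ?thesis by (simp add: sym_decr_rearrangement_def fun_eq_iff)
qed

theorem proposition4p1:
  fixes \<rho> :: "real ^ 'n \<Rightarrow> ennreal"
  assumes "prob_density \<rho>"
    and "second_moment \<rho> < \<infinity>"
  shows "enn2ereal (second_moment \<rho>) - enn2ereal (second_moment (sym_decr_rearrangement \<rho>))
           \<ge> enn2ereal ((wasserstein2 (density_measure \<rho>)
                           (density_measure (sym_decr_rearrangement \<rho>)))\<^sup>2)"
proof -
  have \<rho> [measurable]: "\<rho> \<in> borel_measurable lebesgue" and one: "(\<integral>\<^sup>+ x. \<rho> x \<partial>lebesgue) = 1"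
    using assms(1) by (auto simp: prob_density_def)
  \<comment> \<open>The construction takes place over Borel functions; a Borel representative alters
    neither the measure, nor the moment, nor the rearrangement.\<close>
  obtain f where f [measurable]: "f \<in> borel_measurable borel" and "AE x in lborel. \<rho> x = f x"
    using completion_ex_borel_measurable[OF \<rho>] by auto
  then have ae: "AE x in lebesgue. \<rho> x = f x" by (auto intro: AE_completion)
  have f' [measurable]: "f \<in> borel_measurable lebesgue" by (simp add: measurable_completion)
  let ?g = "sym_decr_rearrangement f"
  have \<rho>g: "sym_decr_rearrangement \<rho> = ?g" by (rule rearrangement_cong_AE[OF ae \<rho> f'])
  have "density lebesgue \<rho> = density lebesgue f"
    using ae by (intro density_cong) auto
  then have \<rho>f: "density_measure \<rho> = density lborel f"
    using density_measure_borel[OF f] by (simp add: density_measure_def)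
  have mass: "(\<integral>\<^sup>+ x. f x \<partial>lborel) = 1"
    using one nn_integral_cong_AE[OF ae] by (simp add: nn_integral_completion)
  then have fin: "(\<integral>\<^sup>+ x. f x \<partial>lborel) < \<infinity>" by simp
  have g [measurable]: "?g \<in> borel_measurable borel" by (rule borel_measurable_rearrangement[OF f fin])
  have sm: "second_moment \<rho> = (\<integral>\<^sup>+ x. ennreal ((norm x)\<^sup>2) * f x \<partial>lborel)"
  proof -
    have "second_moment \<rho> = (\<integral>\<^sup>+ x. ennreal ((norm x)\<^sup>2) * f x \<partial>lebesgue)"
      unfolding second_moment_def using ae by (intro nn_integral_cong_AE) (auto simp: mult.commute)
    then show ?thesis by (simp only: nn_integral_completion)
  qed
  have smg: "second_moment ?g = (\<integral>\<^sup>+ x. ennreal ((norm x)\<^sup>2) * ?g x \<partial>lborel)"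
    unfolding second_moment_def nn_integral_completion by (simp add: mult.commute)
  let ?W = "(wasserstein2 (density lborel f) (density lborel ?g))\<^sup>2"
  have "?W + second_moment ?g \<le> second_moment \<rho>"
  proof (rule ennreal_le_epsilon)
    fix e :: real assume "0 < e"
    then obtain k where k: "coupling_density f ?g k"
      "(\<integral>\<^sup>+ z. ennreal ((dist (fst z) (snd z))\<^sup>2) * k z \<partial>(lborel \<Otimes>\<^sub>M lborel)) + second_moment ?g
       \<le> second_moment \<rho> + ennreal e"
      using rearrangement_coupling[OF f fin] assms(2) unfolding sm smg by blast
    show "?W + second_moment ?g \<le> second_moment \<rho> + ennreal e"
      by (rule order_trans[OF add_right_mono k(2)]) (rule wasserstein2_coupling_density[OF k(1) f g mass])
  qed
  then have le: "enn2ereal ?W + enn2ereal (second_moment ?g) \<le> enn2ereal (second_moment \<rho>)"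
    by (simp add: less_eq_ennreal.rep_eq plus_ennreal.rep_eq)
  \<comment> \<open>Finiteness of the rearranged moment permits moving it across the inequality in
    \<open>ereal\<close>, turning the additive form into the difference.\<close>
  have "second_moment ?g \<le> second_moment \<rho>"
    unfolding sm smg by (rule second_moment_rearrangement_le[OF f fin])
  then have "second_moment ?g < top" using assms(2) by (simp add: le_less_trans)
  then have "\<bar>enn2ereal (second_moment ?g)\<bar> \<noteq> \<infinity>"
    by (cases "second_moment ?g") (auto simp: enn2ereal_ennreal)
  with le show ?thesis
    unfolding \<rho>g \<rho>f density_measure_borel[OF g] by (simp add: ereal_le_minus)
qed

end
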